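(* Let $G$ be a simple graph of size $s>0$ having a vertex labeling $\sigma$ with $\operatorname{FR}(A_\sigma)=\mathcal E(G)/\sqrt{2s}$ (such a graph is necessarily regular). Let $a$ be the common vertex degree, let $L=aI-A_\sigma$ be the Laplacian, and let $\mu$ be an eigenvalue of $A_\sigma$. Suppose that $|\mu|$ is different from the magnitude of every nonzero off-diagonal entry of $FA_\sigma F^\ast$. Then $\lambda=a-\mu$ is an eigenvalue of $L$ and $$\operatorname{FR}_{\min}(\Pi_\lambda)=\sqrt{m(\lambda)},$$ where $m(\lambda)$ is the multiplicity of $\lambda$ as an eigenvalue of $L$.
   Context: Graphs are finite, simple and undirected. A vertex labeling of a graph $G=(V,E)$ of order $N=|V|$ is a bijection $\sigma:V\to\mathbb Z_N=\mathbb Z/N\mathbb Z$. The adjacency matrix under $\sigma$ is the $N\times N$ matrix $A_\sigma$, indexed by $\mathbb Z_N\times\mathbb Z_N$, with $(A_\sigma)_{x,y}=1$ if the vertices labeled $x$ and $y$ are adjacent and $0$ otherwise. $F$ is the unitary Fourier matrix $F_{mx}=\frac1{\sqrt N}e^{-2\pi i mx/N}$. The Fourier ratio of a nonzero $N\times N$ matrix $M$ is $\operatorname{FR}(M)=\|FMF\|_1/\|FMF\|_2$, where $\|\cdot\|_1$ is the entrywise $\ell^1$-norm and $\|\cdot\|_2$ the Frobenius norm. (Replacing $FMF$ by $FMF^\ast$ only permutes columns and does not change the ratio.) The graph energy $\mathcal E(G)$ is the sum of the absolute values of the adjacency eigenvalues counted with multiplicity. For an eigenvalue $\lambda$ of the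 graph Laplacian $L=D-A$, $\Pi_{\lambda,\tau}$ denotes the matrix of the orthogonal projector onto the $\lambda$-eigenspace of $L$ written under the vertex labeling $\tau$, and $\operatorname{FR}_{\min}(\Pi_\lambda)=\min_\tau\operatorname{FR}(\Pi_{\lambda,\tau})$, the minimum over all vertex labelings $\tau$. *)

theory Defs
  imports
    "HOL-Analysis.Analysis"
    "Jordan_Normal_Form.Schur_Decomposition"
    "Jordan_Normal_Form.Spectral_Radius"
begin

text \<open>Edges are two-element subsets of the vertex set, so loops and multiple edges are excluded.\<close>

definition simple_graph :: "'a set \<Rightarrow> 'a set set \<Rightarrow> bool" where
  "simple_graph V E \<longleftrightarrow> finite V \<and> (\<forall>e\<in>E. e \<subseteq> V \<and> card e = 2)"

definition vertex_degree :: "'a set set \<Rightarrow> 'a \<Rightarrow> nat" where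
  "vertex_degree E v = card {w. {v, w} \<in> E}"

text \<open>The residues modulo \<open>N = card V\<close> are represented by \<open>0, \<dots>, N - 1\<close>.\<close>

definition labeling :: "'a set \<Rightarrow> ('a \<Rightarrow> nat) \<Rightarrow> bool" where
  "labeling V \<sigma> \<longleftrightarrow> bij_betw \<sigma> V {..<card V}"

definition adjacency_mat :: "'a set \<Rightarrow> 'a set set \<Rightarrow> ('a \<Rightarrow> nat) \<Rightarrow> complex mat" where
  "adjacency_mat V E \<sigma> = mat (card V) (card V)
     (\<lambda>(x, y). if {inv_into V \<sigma> x, inv_into V \<sigma> y} \<in> E then 1 else 0)"

definition degree_mat :: "'a set \<Rightarrow> 'a set set \<Rightarrow> ('a \<Rightarrow> nat) \<Rightarrow> complex mat" where
  "degree_mat V E \<sigma> = mat (card V) (card V)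
     (\<lambda>(x, y). if x = y then of_nat (vertex_degree E (inv_into V \<sigma> x)) else 0)"

definition laplacian_mat :: "'a set \<Rightarrow> 'a set set \<Rightarrow> ('a \<Rightarrow> nat) \<Rightarrow> complex mat" where
  "laplacian_mat V E \<sigma> = degree_mat V E \<sigma> - adjacency_mat V E \<sigma>"

definition fourier_mat :: "nat \<Rightarrow> complex mat" where
  "fourier_mat N = mat N N (\<lambda>(m, x).
     exp (- 2 * complex_of_real pi * \<i> * of_nat m * of_nat x / of_nat N) / complex_of_real (sqrt (real N)))"

definition entrywise_l1_norm :: "complex mat \<Rightarrow> real" where
  "entrywise_l1_norm M = (\<Sum>i<dim_row M. \<Sum>j<dim_col M. cmod (M $$ (i, j)))"

definition frobenius_norm :: "complex mat \<Rightarrow> real" where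
  "frobenius_norm M = sqrt (\<Sum>i<dim_row M. \<Sum>j<dim_col M. (cmod (M $$ (i, j)))\<^sup>2)"

text \<open>Meant for nonzero square matrices; for the zero matrix the value is \<open>0 / 0 = 0\<close>.\<close>

definition fourier_ratio :: "complex mat \<Rightarrow> real" where
  "fourier_ratio M = (let F = fourier_mat (dim_row M) in
     entrywise_l1_norm (F * M * F) / frobenius_norm (F * M * F))"

abbreviation multiplicity_eigenvalue :: "complex mat \<Rightarrow> complex \<Rightarrow> nat" where
  "multiplicity_eigenvalue A \<equiv> \<lambda>l. Polynomial.order l (char_poly A)"

definition mat_energy :: "complex mat \<Rightarrow> real" where
  "mat_energy A = (\<Sum>l\<in>spectrum A. real (multiplicity_eigenvalue A l) * cmod l)"

text \<open>The choice of the labeling is immaterial: see \<open>graph_energy_eq\<close> below.\<close>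

definition graph_energy :: "'a set \<Rightarrow> 'a set set \<Rightarrow> real" where
  "graph_energy V E = mat_energy (adjacency_mat V E (SOME \<sigma>. labeling V \<sigma>))"

definition eigenspace :: "complex mat \<Rightarrow> complex \<Rightarrow> complex vec set" where
  "eigenspace A l = {v \<in> carrier_vec (dim_row A). A *\<^sub>v v = l \<cdot>\<^sub>v v}"

text \<open>
  The matrix of the orthogonal projector onto a linear subspace \<open>W\<close> of \<open>\<complex>\<^sup>N\<close>:
  \<open>P v\<close> is the element of \<open>W\<close> such that \<open>v - P v\<close> is orthogonal to \<open>W\<close>.
\<close>

definition is_orth_projector :: "nat \<Rightarrow> complex vec set \<Rightarrow> complex mat \<Rightarrow> bool" where
  "is_orth_projector N W P \<longleftrightarrow> P \<in> carrier_mat N N \<and>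
     (\<forall>v\<in>carrier_vec N. P *\<^sub>v v \<in> W \<and> (\<forall>w\<in>W. (v - P *\<^sub>v v) \<bullet>c w = 0))"

definition orth_projector :: "nat \<Rightarrow> complex vec set \<Rightarrow> complex mat" where
  "orth_projector N W = (THE P. is_orth_projector N W P)"

definition laplacian_projector ::
    "'a set \<Rightarrow> 'a set set \<Rightarrow> complex \<Rightarrow> ('a \<Rightarrow> nat) \<Rightarrow> complex mat" where
  "laplacian_projector V E l \<tau> = orth_projector (card V) (eigenspace (laplacian_mat V E \<tau>) l)"

text \<open>
  There are infinitely many functions \<open>\<tau>\<close> when \<open>V\<close> is not the whole type, but the projector depends
  on \<open>\<tau>\<close> only through its restriction to \<open>V\<close>, so the minimum is over a finite set of values.
\<close>

definition FR_min_projector :: "'a set \<Rightarrow> 'a set set \<Rightarrow> complex \<Rightarrow> real" where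
  "FR_min_projector V E l = Min ((\<lambda>\<tau>. fourier_ratio (laplacian_projector V E l \<tau>)) ` {\<tau>. labeling V \<tau>})"

lemma similar_adjacency_mat:
  assumes "finite V" "labeling V \<sigma>" "labeling V \<tau>"
  shows "similar_mat (adjacency_mat V E \<sigma>) (adjacency_mat V E \<tau>)"
proof -
  let ?N = "card V"
  define P where "P = (\<lambda>s t. mat ?N ?N
    (\<lambda>(x, y). if inv_into V s x = inv_into V t y then 1 else 0 :: complex))"
  have inv: "bij_betw (inv_into V s) {..<?N} V" if "labeling V s" for s
    using that unfolding labeling_def by (rule bij_betw_inv_into)
  have PM: "(P s t * M) $$ (x, y) = M $$ (t (inv_into V s x), y)"
    if st: "labeling V s" "labeling V t" and M: "M \<in> carrier_mat ?N ?N" and xy: "x < ?N" "y < ?N"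
    for s t M x y
  proof -
    have sx: "inv_into V s x \<in> V" using inv[OF st(1)] xy by (auto simp: bij_betw_def)
    have eq: "inv_into V s x = inv_into V t k \<longleftrightarrow> k = t (inv_into V s x)" if "k < ?N" for k
      using that sx st(2) unfolding labeling_def
      by (metis bij_betw_inv_into_left bij_betw_inv_into_right lessThan_iff)
    have lt: "t (inv_into V s x) < ?N" using sx st(2) unfolding labeling_def bij_betw_def by auto
    have "(P s t * M) $$ (x, y) = (\<Sum>k<?N. (if inv_into V s x = inv_into V t k then 1 else 0) * M $$ (k, y))"
      using M xy by (simp add: P_def scalar_prod_def atLeast0LessThan)
    also have "\<dots> = (\<Sum>k<?N. if k = t (inv_into V s x) then M $$ (k, y) else 0)"
      by (intro sum.cong) (auto simp: eq)
    also have "\<dots> = M $$ (t (inv_into V s x), y)" using lt by simp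
    finally show ?thesis .
  qed
  have left: "inv_into V t (t (inv_into V s x)) = inv_into V s x"
    if "labeling V s" "labeling V t" "x < ?N" for s t x
    using that inv[OF that(1)] unfolding labeling_def
    by (metis bij_betw_apply bij_betw_inv_into_left lessThan_iff)
  have lt: "t (inv_into V s x) < ?N"
    if "labeling V s" "labeling V t" "x < ?N" for s t x
    using that inv[OF that(1)] unfolding labeling_def
    by (metis bij_betw_apply lessThan_iff)
  have car: "P s t \<in> carrier_mat ?N ?N" for s t by (simp add: P_def)
  have inj: "inv_into V s x = inv_into V s y \<longleftrightarrow> x = y"
    if "labeling V s" "x < ?N" "y < ?N" for s x y
    using inv[OF that(1)] that by (auto simp: bij_betw_def inj_on_def)
  have one: "P s t * P t s = 1\<^sub>m ?N" if "labeling V s" "labeling V t" for s t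
    using that by (intro eq_matI) (auto simp: PM car, auto simp: P_def left lt inj)
  let ?A = "adjacency_mat V E"
  have carA: "?A s \<in> carrier_mat ?N ?N" for s by (simp add: adjacency_mat_def)
  have "?A \<sigma> * P \<sigma> \<tau> = P \<sigma> \<tau> * ?A \<tau>"
  proof (intro eq_matI)
    fix x y assume "x < dim_row (P \<sigma> \<tau> * ?A \<tau>)" "y < dim_col (P \<sigma> \<tau> * ?A \<tau>)"
    then have xy: "x < ?N" "y < ?N" by (auto simp: P_def adjacency_mat_def)
    have eq: "inv_into V \<sigma> k = inv_into V \<tau> y \<longleftrightarrow> k = \<sigma> (inv_into V \<tau> y)" if "k < ?N" for k
      using left[OF assms(3,2) xy(2)] inj[OF assms(2) that lt[OF assms(3,2) xy(2)]] by auto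
    have "(?A \<sigma> * P \<sigma> \<tau>) $$ (x, y) =
       (\<Sum>k<?N. ?A \<sigma> $$ (x, k) * (if inv_into V \<sigma> k = inv_into V \<tau> y then 1 else 0))"
      using carA[of \<sigma>] xy by (simp add: P_def scalar_prod_def atLeast0LessThan)
    also have "\<dots> = (\<Sum>k<?N. if k = \<sigma> (inv_into V \<tau> y) then ?A \<sigma> $$ (x, k) else 0)"
      by (intro sum.cong) (auto simp: eq)
    also have "\<dots> = ?A \<sigma> $$ (x, \<sigma> (inv_into V \<tau> y))" using lt[OF assms(3,2) xy(2)] by simp
    also have "\<dots> = ?A \<tau> $$ (\<tau> (inv_into V \<sigma> x), y)"
      using xy lt assms by (simp add: adjacency_mat_def left)
    also have "\<dots> = (P \<sigma> \<tau> * ?A \<tau>) $$ (x, y)" using PM[OF assms(2,3) carA xy] by simp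
    finally show "(?A \<sigma> * P \<sigma> \<tau>) $$ (x, y) = (P \<sigma> \<tau> * ?A \<tau>) $$ (x, y)" .
  qed (auto simp: P_def adjacency_mat_def)
  then have A: "?A \<sigma> = P \<sigma> \<tau> * ?A \<tau> * P \<tau> \<sigma>"
    using one[OF assms(2,3)] car carA
    by (metis assoc_mult_mat right_mult_one_mat)
  have "{?A \<sigma>, ?A \<tau>, P \<sigma> \<tau>, P \<tau> \<sigma>} \<subseteq> carrier_mat ?N ?N"
    using car carA by blast
  then show ?thesis
    using one[OF assms(2,3)] one[OF assms(3,2)] A by (rule similar_matI)
qed

lemma graph_energy_eq:
  assumes "finite V" "labeling V \<sigma>"
  shows "graph_energy V E = mat_energy (adjacency_mat V E \<sigma>)"
proof -
  let ?\<tau> = "SOME \<tau>. labeling V \<tau>"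
  have "labeling V ?\<tau>" using assms(2) by (rule someI[of "labeling V"])
  then have "char_poly (adjacency_mat V E ?\<tau>) = char_poly (adjacency_mat V E \<sigma>)"
    using assms by (intro char_poly_similar similar_adjacency_mat)
  moreover have "spectrum (adjacency_mat V E t) = {l. poly (char_poly (adjacency_mat V E t)) l = 0}" for t
    by (auto simp: spectrum_def adjacency_mat_def eigenvalue_root_char_poly[of _ "card V"])
  ultimately show ?thesis
    unfolding graph_energy_def mat_energy_def by (simp only:)
qed

end

theory Submission
  imports Defs
begin

text \<open>
  Write \<open>B = F A F\<^sup>*\<close>, a Hermitian matrix with the spectrum of \<open>A\<close>. The hypothesis says that
  \<open>\<parallel>B\<parallel>\<^sub>1\<close> equals the trace norm of \<open>B\<close>. The trace norm is \<open>tr (B S)\<close> with the unitary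
  \<open>S = sgn B\<close>, whose entries have modulus at most 1 and whose columns have norm 1; so equality forces
  every row of \<open>B\<close> to have at most one nonzero entry. As \<open>B\<^sub>0\<^sub>0 > 0\<close>, the first column of
  \<open>F\<^sup>*\<close>, which is constant, is an eigenvector of \<open>A\<close>, and the graph is regular. Up to a
  permutation \<open>B\<close> consists of diagonal entries and of \<open>2 \<times> 2\<close> blocks with zero diagonal and
  eigenvalues \<open>\<plusminus>\<bar>B\<^sub>i\<^sub>j\<bar>\<close>; when \<open>\<bar>\<mu>\<bar>\<close> avoids these, the \<open>\<mu>\<close>-eigenspace of \<open>B\<close> is spanned by
  coordinate vectors, and \<open>F \<Pi> F\<^sup>*\<close> is a 0-1 diagonal matrix. For any labeling,
  \<open>F \<Pi> F\<^sup>*\<close> is a projector with trace \<open>m\<close>, so its entrywise norm is at least \<open>m\<close> and its Frobenius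
  norm is \<open>\<surd>m\<close>.
\<close>

subsection \<open>Adjoints and unitary matrices\<close>

lemma mat_adjoint_carrier [simp]:
  "A \<in> carrier_mat m n \<Longrightarrow> mat_adjoint A \<in> carrier_mat n m"
  by (auto simp: mat_adjoint_def)

lemma mat_adjoint_index [simp]:
  assumes "i < dim_col A" "j < dim_row A"
  shows "mat_adjoint (A :: complex mat) $$ (i, j) = cnj (A $$ (j, i))"
  using assms by (simp add: mat_adjoint_def mat_of_rows_def)

lemma mat_adjoint_dim [simp]:
  "dim_row (mat_adjoint A) = dim_col A" "dim_col (mat_adjoint A) = dim_row A"
  by (simp_all add: mat_adjoint_def)

lemma mat_adjoint_adjoint [simp]: "mat_adjoint (mat_adjoint A) = (A :: complex mat)"
  by (rule eq_matI) auto

lemma mat_adjoint_mult: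
  assumes "A \<in> carrier_mat m n" "B \<in> carrier_mat n k"
  shows "mat_adjoint (A * B) = mat_adjoint B * (mat_adjoint A :: complex mat)"
  using assms by (intro eq_matI) (auto simp: scalar_prod_def mult.commute)

lemma mat_adjoint_one [simp]: "mat_adjoint (1\<^sub>m n) = (1\<^sub>m n :: complex mat)"
  by (rule eq_matI) auto

lemma mat_adjoint_zero [simp]: "mat_adjoint (0\<^sub>m m n) = (0\<^sub>m n m :: complex mat)"
  by (rule eq_matI) auto

lemma mat_adjoint_four_block:
  assumes "A \<in> carrier_mat k l" "B \<in> carrier_mat k n" "C \<in> carrier_mat m l" "D \<in> carrier_mat m n"
  shows "mat_adjoint (four_block_mat A B C D :: complex mat) =
    four_block_mat (mat_adjoint A) (mat_adjoint C) (mat_adjoint B) (mat_adjoint D)"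
  using assms by (intro eq_matI) auto

definition unitary_mat :: "nat \<Rightarrow> complex mat \<Rightarrow> bool" where
  "unitary_mat n U \<longleftrightarrow> U \<in> carrier_mat n n \<and> mat_adjoint U * U = 1\<^sub>m n \<and> U * mat_adjoint U = 1\<^sub>m n"

text \<open>A left inverse of a square matrix is also a right inverse, so one of the two identities
  suffices.\<close>

lemma unitary_matI:
  assumes "U \<in> carrier_mat n n" "mat_adjoint U * U = 1\<^sub>m n"
  shows "unitary_mat n U"
  using assms mat_mult_left_right_inverse[of "mat_adjoint U" n U] by (simp add: unitary_mat_def)

lemma unitary_matD:
  assumes "unitary_mat n U"
  shows "U \<in> carrier_mat n n" "mat_adjoint U \<in> carrier_mat n n"
    "mat_adjoint U * U = 1\<^sub>m n" "U * mat_adjoint U = 1\<^sub>m n"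
  using assms by (auto simp: unitary_mat_def)

lemma unitary_mat_mult:
  assumes "unitary_mat n U" "unitary_mat n W"
  shows "unitary_mat n (U * W)"
proof (rule unitary_matI)
  note U = unitary_matD[OF assms(1)] and W = unitary_matD[OF assms(2)]
  show "U * W \<in> carrier_mat n n" using U W by simp
  have "mat_adjoint (U * W) * (U * W) = mat_adjoint W * (mat_adjoint U * (U * W))"
    using U(1,2) W(1,2) by (simp add: mat_adjoint_mult assoc_mult_mat[of _ n n _ n _ n])
  also have "mat_adjoint U * (U * W) = W"
    using U W(1) by (simp flip: assoc_mult_mat[of _ n n _ n _ n])
  finally show "mat_adjoint (U * W) * (U * W) = 1\<^sub>m n" using W by simp
qed

text \<open>Serves the induction in the spectral theorem: a unitary change of basis on the
  orthogonal complement of the first coordinate vector is extended to the whole space.\<close>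

lemma unitary_mat_four_block:
  assumes "unitary_mat n U"
  shows "unitary_mat (1 + n) (four_block_mat (1\<^sub>m 1) (0\<^sub>m 1 n) (0\<^sub>m n 1) U)"
proof (rule unitary_matI)
  note U = unitary_matD[OF assms]
  let ?U = "four_block_mat (1\<^sub>m 1) (0\<^sub>m 1 n) (0\<^sub>m n 1) U"
  have "mat_adjoint ?U = four_block_mat (1\<^sub>m 1) (0\<^sub>m 1 n) (0\<^sub>m n 1) (mat_adjoint U)"
    using U by (subst mat_adjoint_four_block) auto
  then show "mat_adjoint ?U * ?U = 1\<^sub>m (1 + n)"
    using U by (simp add: mult_four_block_mat[of _ 1 1 _ n _ n _ _ 1 _ n])
qed (use unitary_matD[OF assms] in auto)

text \<open>Complete \<open>v\<close> to a basis and run Gram-Schmidt, which keeps the first vector.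
  The result is orthogonal but not normalized, so each column is scaled by the inverse
  \<open>s j\<close> of its norm; \<open>c\<close> is \<open>s 0\<close>.\<close>

lemma unitary_mat_first_col:
  fixes v :: "complex vec"
  assumes v: "v \<in> carrier_vec n" "v \<noteq> 0\<^sub>v n"
  obtains U c where "unitary_mat n U" "col U 0 = c \<cdot>\<^sub>v v"
proof -
  interpret cof_vec_space n "TYPE(complex)" .
  define b where "b = basis_completion v"
  define ws where "ws = gram_schmidt n b"
  have n: "n \<noteq> 0" using v by (cases n) auto
  note bc = basis_completion[OF v, folded b_def]
  obtain vs where bv: "b = v # vs" using bc n by (cases b) auto
  have ws: "set ws \<subseteq> carrier_vec n" "corthogonal ws" "length ws = n"
    using gram_schmidt_result[of b ws] bc ws_def by auto
  have hdws: "hd ws = v" using gram_schmidt_hd[OF v(1), of vs, folded bv] by (simp add: ws_def)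
  define s where "s = (\<lambda>j. 1 / complex_of_real (sqrt (Re (ws ! j \<bullet>c ws ! j))))"
  define U where "U = mat n n (\<lambda>(i, j). s j * ws ! j $ i)"
  have wsc [simp]: "ws ! j \<in> carrier_vec n" if "j < n" for j using ws that by auto
  have nz: "Re (ws ! j \<bullet>c ws ! j) > 0 \<and> Im (ws ! j \<bullet>c ws ! j) = 0" if "j < n" for j
  proof -
    \<comment> \<open>In the order on complex numbers, being at least 0 includes having imaginary
      part 0; the squared norm is thus a positive real.\<close>
    have "ws ! j \<bullet>c ws ! j \<noteq> 0" using corthogonalD[OF ws(2), of j j] that ws(3) by simp
    moreover have "ws ! j \<bullet>c ws ! j \<ge> 0" by (rule conjugate_square_ge_0_vec)
    ultimately show ?thesis by (auto simp: less_eq_complex_def complex_eq_iff)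
  qed
  have "mat_adjoint U * U = 1\<^sub>m n"
  proof (rule eq_matI)
    fix i j assume "i < dim_row (1\<^sub>m n :: complex mat)" "j < dim_col (1\<^sub>m n :: complex mat)"
    then have ij: "i < n" "j < n" by auto
    have "(mat_adjoint U * U) $$ (i, j) = (\<Sum>k<n. cnj (s i) * s j * (ws ! j $ k * cnj (ws ! i $ k)))"
      using ij by (simp add: U_def scalar_prod_def atLeast0LessThan mult_ac)
    also have "\<dots> = cnj (s i) * s j * (ws ! j \<bullet>c ws ! i)"
      using ij by (simp add: scalar_prod_def atLeast0LessThan sum_distrib_left carrier_vecD[OF wsc])
    also have "\<dots> = (if i = j then 1 else 0)"
    proof (cases "i = j")
      case True
      have "ws ! j \<bullet>c ws ! j = complex_of_real (Re (ws ! j \<bullet>c ws ! j))"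
        using nz[OF ij(2)] by (simp add: complex_eq_iff)
      moreover have "complex_of_real (sqrt r) * complex_of_real (sqrt r) = complex_of_real r" if "r > 0" for r
        using that by (simp flip: of_real_mult)
      moreover have "ws ! j \<bullet>c ws ! j \<noteq> 0" using nz[OF ij(2)] by auto
      ultimately show ?thesis using True nz[OF ij(2)] by (simp add: s_def)
    next
      case False
      then show ?thesis using corthogonalD[OF ws(2), of j i] ij ws(3) by simp
    qed
    finally show "(mat_adjoint U * U) $$ (i, j) = 1\<^sub>m n $$ (i, j)" using ij by simp
  qed (auto simp: U_def)
  then have "unitary_mat n U" by (intro unitary_matI) (auto simp: U_def)
  moreover have "col U 0 = s 0 \<cdot>\<^sub>v v"
  proof -
    have "ws ! 0 = v" using hdws ws(3) n by (metis hd_conv_nth length_0_conv)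
    then show ?thesis using n v by (intro eq_vecI) (auto simp: U_def)
  qed
  ultimately show ?thesis using that by blast
qed

subsection \<open>The spectral theorem for Hermitian matrices\<close>

text \<open>The matrix whose orthonormal eigenvectors are the columns of \<open>U\<close>, with
  eigenvalues \<open>d\<close>. For a fixed unitary \<open>U\<close>, products, differences and
  adjoints act pointwise on \<open>d\<close>, so identities between functions of one matrix reduce
  to identities between scalars.\<close>

definition unitary_conj :: "nat \<Rightarrow> complex mat \<Rightarrow> (nat \<Rightarrow> complex) \<Rightarrow> complex mat" where
  "unitary_conj n U d = U * mat_diag n d * mat_adjoint U"

lemma unitary_conj_carrier [simp]: "U \<in> carrier_mat n n \<Longrightarrow> unitary_conj n U d \<in> carrier_mat n n"
  unfolding unitary_conj_def by (intro mult_carrier_mat[of _ n n]) auto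

lemma unitary_conj_of_diagonalized:
  assumes "unitary_mat n U" "A \<in> carrier_mat n n" "mat_adjoint U * A * U = mat_diag n d"
  shows "A = unitary_conj n U d"
proof -
  note U = unitary_matD[OF assms(1)]
  have "unitary_conj n U d = U * (mat_adjoint U * A * U) * mat_adjoint U"
    by (simp add: unitary_conj_def assms(3))
  also have "\<dots> = (U * mat_adjoint U) * A * (U * mat_adjoint U)"
    using U(1,2) assms(2) by (simp add: assoc_mult_mat[of _ n n _ n _ n] mult_carrier_mat[of _ n n _ n])
  finally show ?thesis using U assms(2) by simp
qed

text \<open>Deflation by induction on the size: a unitary \<open>W\<close> whose first column is an
  eigenvector splits off a \<open>1 \<times> 1\<close> block, and the remaining block is Hermitian
  of size \<open>n\<close>.\<close>

lemma hermitian_diagonalizable_aux: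
  assumes "A \<in> carrier_mat n n" "mat_adjoint A = (A :: complex mat)"
  shows "\<exists>U d. unitary_mat n U \<and> mat_adjoint U * A * U = mat_diag n d"
  using assms
proof (induction n arbitrary: A)
  case 0
  have "unitary_mat 0 (1\<^sub>m 0)" by (rule unitary_matI) auto
  moreover have "mat_adjoint (1\<^sub>m 0) * A * 1\<^sub>m 0 = mat_diag 0 (\<lambda>_. 0)"
    by (rule eq_matI) (auto simp: mat_diag_def)
  ultimately show ?case by blast
next
  case (Suc n)
  note A = Suc.prems(1)
  obtain e where "eigenvalue A e"
    using spectrum_non_empty[OF A] by (auto simp: spectrum_def)
  then obtain v where v: "v \<in> carrier_vec (Suc n)" "v \<noteq> 0\<^sub>v (Suc n)" "A *\<^sub>v v = e \<cdot>\<^sub>v v"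
    using A by (auto simp: eigenvalue_def eigenvector_def)
  obtain W c where W: "unitary_mat (Suc n) W" "col W 0 = c \<cdot>\<^sub>v v"
    by (rule unitary_mat_first_col[OF v(1,2)])
  note WD = unitary_matD[OF W(1)]
  define A' where "A' = mat_adjoint W * A * W"
  have A': "A' \<in> carrier_mat (Suc n) (Suc n)"
    unfolding A'_def using WD(1,2) A by (intro mult_carrier_mat[of _ "Suc n" "Suc n"])
  have hA': "mat_adjoint A' = A'"
    unfolding A'_def using WD(1,2) A Suc.prems(2)
    by (simp add: mat_adjoint_mult[of _ "Suc n" "Suc n" _ "Suc n"]
        assoc_mult_mat[of _ "Suc n" "Suc n" _ "Suc n" _ "Suc n"])
  \<comment> \<open>The first column of \<open>A'\<close> is the adjoint of \<open>W\<close> applied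
    to \<open>e\<close> times the first column of \<open>W\<close>, hence \<open>e\<close> times the
    first unit vector.\<close>
  have "A *\<^sub>v col W 0 = e \<cdot>\<^sub>v col W 0"
    using v A by (simp add: W(2) mult_mat_vec[of _ "Suc n" "Suc n"] smult_smult_assoc mult.commute)
  moreover have "col A' 0 = mat_adjoint W *\<^sub>v col (A * W) 0"
    unfolding A'_def assoc_mult_mat[OF WD(2) A WD(1)]
    by (rule col_mult2[OF WD(2) mult_carrier_mat[OF A WD(1)]]) simp
  moreover have "col (A * W) 0 = A *\<^sub>v col W 0"
    by (rule col_mult2[OF A WD(1)]) simp
  ultimately have "col A' 0 = mat_adjoint W *\<^sub>v (e \<cdot>\<^sub>v col W 0)" by simp
  also have "\<dots> = e \<cdot>\<^sub>v col (mat_adjoint W * W) 0"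
    by (simp add: mult_mat_vec[OF WD(2) col_carrier_vec[OF zero_less_Suc WD(1)]] col_mult2[OF WD(2,1)]
        del: col_mult)
  finally have col: "col A' 0 = e \<cdot>\<^sub>v unit_vec (Suc n) 0" using WD by simp
  have c0: "A' $$ (i, 0) = (if i = 0 then e else 0)" if "i < Suc n" for i
    using that A' arg_cong[OF col, of "\<lambda>x. x $ i"] by (auto simp: unit_vec_def)
  \<comment> \<open>Hermitian symmetry carries the zeros of the first column over to the first row,
    which gives the block form.\<close>
  have r0: "A' $$ (0, i) = (if i = 0 then e else 0)" if "i < Suc n" for i
    using that A' c0[OF that] c0[of 0] hA' mat_adjoint_index[of 0 A' i]
    by (cases "i = 0") auto
  define M where "M = mat n n (\<lambda>(i, j). A' $$ (Suc i, Suc j))"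
  have M: "M \<in> carrier_mat n n" by (simp add: M_def)
  have hM: "mat_adjoint M = M"
  proof (rule eq_matI)
    fix i j assume "i < dim_row M" "j < dim_col M"
    then have ij: "i < n" "j < n" by (auto simp: M_def)
    then show "mat_adjoint M $$ (i, j) = M $$ (i, j)"
      using A' hA' mat_adjoint_index[of "Suc i" A' "Suc j"] by (simp add: M_def)
  qed (auto simp: M_def)
  have A'b: "A' = four_block_mat (mat 1 1 (\<lambda>_. e)) (0\<^sub>m 1 n) (0\<^sub>m n 1) M"
  proof (rule eq_matI)
    fix i j assume "i < dim_row (four_block_mat (mat 1 1 (\<lambda>_. e)) (0\<^sub>m 1 n) (0\<^sub>m n 1) M)"
      "j < dim_col (four_block_mat (mat 1 1 (\<lambda>_. e)) (0\<^sub>m 1 n) (0\<^sub>m n 1) M)"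
    then have ij: "i < Suc n" "j < Suc n" by (auto simp: M_def)
    show "A' $$ (i, j) = four_block_mat (mat 1 1 (\<lambda>_. e)) (0\<^sub>m 1 n) (0\<^sub>m n 1) M $$ (i, j)"
      using ij c0[of i] r0[of j] by (cases i; cases j) (auto simp: M_def)
  qed (use A' in \<open>auto simp: M_def\<close>)
  obtain U d where U: "unitary_mat n U" "mat_adjoint U * M * U = mat_diag n d"
    using Suc.IH[OF M hM] by blast
  note UD = unitary_matD[OF U(1)]
  let ?U = "four_block_mat (1\<^sub>m 1) (0\<^sub>m 1 n) (0\<^sub>m n 1) U"
  have uU: "unitary_mat (Suc n) ?U" using unitary_mat_four_block[OF U(1)] by simp
  have aU: "mat_adjoint ?U = four_block_mat (1\<^sub>m 1) (0\<^sub>m 1 n) (0\<^sub>m n 1) (mat_adjoint U)"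
    using UD by (subst mat_adjoint_four_block) auto
  have UMU: "mat_adjoint U * M \<in> carrier_mat n n" using UD M by auto
  have "mat_adjoint ?U * A' * ?U = four_block_mat (mat 1 1 (\<lambda>_. e)) (0\<^sub>m 1 n) (0\<^sub>m n 1) (mat_diag n d)"
    unfolding aU A'b using UD(1,2) M UMU
    by (simp add: mult_four_block_mat[of _ 1 1 _ n _ n _ _ 1 _ n] U(2))
  also have "\<dots> = mat_diag (Suc n) (case_nat e d)"
    by (rule eq_matI) (auto simp: mat_diag_def split: nat.splits)
  also have "mat_adjoint ?U * A' * ?U = mat_adjoint (W * ?U) * A * (W * ?U)"
    unfolding A'_def using WD(1,2) unitary_matD(1,2)[OF uU] A
    by (simp add: mat_adjoint_mult[of _ "Suc n" "Suc n" _ "Suc n"]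
        assoc_mult_mat[of _ "Suc n" "Suc n" _ "Suc n" _ "Suc n"]
        mult_carrier_mat[of _ "Suc n" "Suc n" _ "Suc n"])
  finally show ?case using unitary_mat_mult[OF W(1) uU] by blast
qed

text \<open>The diagonalized matrix is Hermitian again, so its diagonal entries are real. Having
  \<open>d\<close> real-valued makes signs and absolute values of eigenvalues available
  later.\<close>

theorem hermitian_spectral:
  assumes "A \<in> carrier_mat n n" "mat_adjoint A = (A :: complex mat)"
  obtains U d where "unitary_mat n U" "A = unitary_conj n U (\<lambda>i. complex_of_real (d i))"
proof -
  obtain U d where U: "unitary_mat n U" "mat_adjoint U * A * U = mat_diag n d"
    using hermitian_diagonalizable_aux[OF assms] by blast
  note UD = unitary_matD[OF U(1)]
  have "mat_adjoint (mat_diag n d) = mat_diag n d"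
    unfolding U(2)[symmetric] using UD(1,2) assms
    by (simp add: mat_adjoint_mult[of _ n n _ n] assoc_mult_mat[of _ n n _ n _ n])
  then have "cnj (d i) = d i" if "i < n" for i
    using that mat_adjoint_index[of i "mat_diag n d" i] by (simp add: mat_diag_def)
  then have "mat_diag n d = mat_diag n (\<lambda>i. complex_of_real (Re (d i)))"
    by (intro eq_matI) (auto simp: mat_diag_def complex_eq_iff)
  then show ?thesis using U that unitary_conj_of_diagonalized[OF U(1) assms(1)] by metis
qed

section \<open>Calculus of matrices in a fixed orthonormal eigenbasis\<close>

lemma unitary_conj_index:
  assumes "U \<in> carrier_mat n n" "i < n" "j < n"
  shows "unitary_conj n U d $$ (i, j) = (\<Sum>k<n. U $$ (i, k) * d k * cnj (U $$ (j, k)))"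
  using assms
  by (simp add: unitary_conj_def mat_diag_mult_right[of _ n n] scalar_prod_def atLeast0LessThan)

lemma unitary_mat_col_norm:
  assumes "unitary_mat n U" "k < n"
  shows "(\<Sum>i<n. U $$ (i, k) * cnj (U $$ (i, k))) = 1"
proof -
  note U = unitary_matD[OF assms(1)]
  have "(mat_adjoint U * U) $$ (k, k) = (\<Sum>i<n. U $$ (i, k) * cnj (U $$ (i, k)))"
    using U(1) assms(2) by (simp add: scalar_prod_def atLeast0LessThan mult.commute)
  then show ?thesis using U(3) assms(2) by simp
qed

text \<open>After exchanging the sums, \<open>d k\<close> is weighted by the squared norm of column
  \<open>k\<close> of \<open>U\<close>, which is 1.\<close>

lemma unitary_conj_trace:
  assumes "unitary_mat n U"
  shows "(\<Sum>i<n. unitary_conj n U d $$ (i, i)) = (\<Sum>k<n. d k)"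
proof -
  have "(\<Sum>i<n. unitary_conj n U d $$ (i, i)) = (\<Sum>i<n. \<Sum>k<n. d k * (U $$ (i, k) * cnj (U $$ (i, k))))"
    using unitary_matD(1)[OF assms] by (simp add: unitary_conj_index mult_ac)
  also have "\<dots> = (\<Sum>k<n. d k * (\<Sum>i<n. U $$ (i, k) * cnj (U $$ (i, k))))"
    by (subst sum.swap) (simp add: sum_distrib_left)
  finally show ?thesis using unitary_mat_col_norm[OF assms] by simp
qed

lemma unitary_conj_mult:
  assumes "unitary_mat n U"
  shows "unitary_conj n U d * unitary_conj n U e = unitary_conj n U (\<lambda>k. d k * e k)"
proof -
  note U = unitary_matD[OF assms]
  have X: "U * mat_diag n d \<in> carrier_mat n n" "mat_diag n e * mat_adjoint U \<in> carrier_mat n n"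
    using U by (auto intro: mult_carrier_mat[of _ n n])
  have "unitary_conj n U d * unitary_conj n U e
      = (U * mat_diag n d) * ((mat_adjoint U * U) * (mat_diag n e * mat_adjoint U))"
    unfolding unitary_conj_def using U(1,2) X
    by (simp add: assoc_mult_mat[of _ n n _ n _ n] mult_carrier_mat[of _ n n _ n])
  also have "\<dots> = U * (mat_diag n d * mat_diag n e) * mat_adjoint U"
    using U X
    by (simp add: assoc_mult_mat[of _ n n _ n _ n] mult_carrier_mat[of _ n n _ n]
        left_mult_one_mat[of _ n n] del: mat_diag_diag)
  finally show ?thesis by (simp add: unitary_conj_def)
qed

lemma unitary_conj_adjoint:
  assumes "U \<in> carrier_mat n n"
  shows "mat_adjoint (unitary_conj n U d) = unitary_conj n U (\<lambda>k. cnj (d k))"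
  using assms
  by (intro eq_matI) (auto simp: unitary_conj_index mult_ac carrier_matD[OF unitary_conj_carrier])

lemma unitary_conj_cong:
  assumes "\<And>k. k < n \<Longrightarrow> d k = e k"
  shows "unitary_conj n U d = unitary_conj n U e"
proof -
  have "mat_diag n d = mat_diag n e"
    by (rule eq_matI) (auto simp: mat_diag_def assms)
  then show ?thesis by (simp add: unitary_conj_def)
qed

lemma unitary_conj_const:
  assumes "unitary_mat n U"
  shows "unitary_conj n U (\<lambda>_. c) = c \<cdot>\<^sub>m 1\<^sub>m n"
proof -
  note U = unitary_matD[OF assms]
  have "unitary_conj n U (\<lambda>_. c) = c \<cdot>\<^sub>m (U * mat_adjoint U)"
    using U(1) by (intro eq_matI)
      (auto simp: unitary_conj_index scalar_prod_def atLeast0LessThan sum_distrib_left mult_ac carrier_matD[OF unitary_conj_carrier])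
  then show ?thesis using U by simp
qed

lemma unitary_conj_one:
  assumes "unitary_mat n U"
  shows "unitary_conj n U (\<lambda>_. 1) = 1\<^sub>m n"
  unfolding unitary_conj_const[OF assms] by (intro eq_matI) auto

lemma unitary_conj_diff:
  assumes "U \<in> carrier_mat n n"
  shows "unitary_conj n U d - unitary_conj n U e = unitary_conj n U (\<lambda>k. d k - e k)"
  using assms
  by (intro eq_matI)
     (auto simp: unitary_conj_index carrier_matD[OF unitary_conj_carrier] algebra_simps simp flip: sum_subtractf)

lemma unitary_conj_conj:
  assumes "unitary_mat n F" "unitary_mat n U"
  shows "F * unitary_conj n U d * mat_adjoint F = unitary_conj n (F * U) d"
proof -
  note U = unitary_matD[OF assms(2)] and F = unitary_matD[OF assms(1)]
  show ?thesis unfolding unitary_conj_def using U(1,2) F(1,2)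
    by (simp add: mat_adjoint_mult[of _ n n _ n] assoc_mult_mat[of _ n n _ n _ n] mult_carrier_mat[of _ n n _ n])
qed

text \<open>The squared norm is the trace of \<open>?M * mat_adjoint ?M\<close>, whose eigenvalues
  are the squared moduli of those of \<open>?M\<close>. The value does not involve \<open>U\<close>,
  so conjugation by the Fourier matrix preserves the norm.\<close>

lemma unitary_conj_frobenius:
  assumes "unitary_mat n U"
  shows "frobenius_norm (unitary_conj n U d) = sqrt (\<Sum>k<n. (cmod (d k))\<^sup>2)"
proof -
  note U = unitary_matD[OF assms]
  let ?M = "unitary_conj n U d"
  have M: "?M \<in> carrier_mat n n" using U by simp
  have "complex_of_real (\<Sum>i<n. \<Sum>j<n. (cmod (?M $$ (i, j)))\<^sup>2) = (\<Sum>i<n. (?M * mat_adjoint ?M) $$ (i, i))"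
    using M by (simp add: scalar_prod_def atLeast0LessThan complex_norm_square del: of_real_power)
  also have "\<dots> = (\<Sum>k<n. d k * cnj (d k))"
    using U(1) by (simp add: unitary_conj_adjoint unitary_conj_mult[OF assms] unitary_conj_trace[OF assms])
  also have "\<dots> = complex_of_real (\<Sum>k<n. (cmod (d k))\<^sup>2)"
    by (simp add: complex_norm_square del: of_real_power)
  finally have "(\<Sum>i<n. \<Sum>j<n. (cmod (?M $$ (i, j)))\<^sup>2) = (\<Sum>k<n. (cmod (d k))\<^sup>2)"
    using of_real_eq_iff by blast
  then show ?thesis using M by (simp add: frobenius_norm_def)
qed

text \<open>By similarity to the diagonal matrix of \<open>d\<close>, the characteristic polynomial
  is a product of linear factors, and the order at \<open>l\<close> counts those with root
  \<open>l\<close>.\<close>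

lemma order_unitary_conj:
  assumes "unitary_mat n U"
  shows "Polynomial.order l (char_poly (unitary_conj n U d)) = card {i. i < n \<and> d i = l}"
proof -
  note U = unitary_matD[OF assms]
  have "{unitary_conj n U d, mat_diag n d, U, mat_adjoint U} \<subseteq> carrier_mat n n" using U by simp
  then have "similar_mat (unitary_conj n U d) (mat_diag n d)"
    using U(4,3) by (rule similar_matI) (simp add: unitary_conj_def)
  then have "char_poly (unitary_conj n U d) = char_poly (mat_diag n d)" by (rule char_poly_similar)
  also have "\<dots> = (\<Prod>a\<leftarrow>diag_mat (mat_diag n d). [:- a, 1:])"
    by (rule char_poly_upper_triangular[of _ n]) (auto simp: mat_diag_def)
  also have "diag_mat (mat_diag n d) = map d [0..<n]"
    by (auto simp: diag_mat_def mat_diag_def)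
  finally have cp: "char_poly (unitary_conj n U d) = (\<Prod>i\<leftarrow>[0..<n]. [:- d i, 1:])" by (simp add: o_def)
  have ord: "Polynomial.order l [:- a, 1:] = (if a = l then 1 else 0)" for a
    using order_power_n_n[of a 1] by (auto intro!: order_0I)
  have "Polynomial.order l (char_poly (unitary_conj n U d)) = (\<Sum>i\<leftarrow>[0..<n]. if d i = l then 1 else 0)"
    unfolding cp by (subst order_prod_list) (auto simp: o_def ord)
  also have "\<dots> = (\<Sum>i\<in>{0..<n}. if d i = l then 1 else 0)"
    by (simp add: interv_sum_list_conv_sum_set_nat)
  also have "\<dots> = card {i. i < n \<and> d i = l}"
    by (simp add: sum.If_cases) (rule arg_cong[where f = card], auto)
  finally show ?thesis .
qed

text \<open>Identifies the eigenspace with the fixed vectors of the spectral projector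
  \<open>?P\<close>, through the identities \<open>?D * ?P = l ?P\<close> and
  \<open>1 - ?P = R * (?D - l)\<close>.\<close>

lemma unitary_conj_mult_vec_iff:
  assumes "unitary_mat n U" "v \<in> carrier_vec n"
  shows "unitary_conj n U d *\<^sub>v v = l \<cdot>\<^sub>v v \<longleftrightarrow>
    unitary_conj n U (\<lambda>i. if d i = l then 1 else 0) *\<^sub>v v = v"
    (is "?D *\<^sub>v v = _ \<longleftrightarrow> ?P *\<^sub>v v = v")
proof
  note U = unitary_matD[OF assms(1)]
  \<comment> \<open>The reduced resolvent: it inverts \<open>?D - l\<close> off the
    \<open>l\<close>-eigenspace and is 0 on it.\<close>
  define R where "R = unitary_conj n U (\<lambda>i. if d i = l then 0 else 1 / (d i - l))"
  have car: "?D \<in> carrier_mat n n" "?P \<in> carrier_mat n n" "R \<in> carrier_mat n n"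
    "unitary_conj n U (\<lambda>_. l) \<in> carrier_mat n n" using U by (auto simp: R_def)
  have l: "unitary_conj n U (\<lambda>_. l) *\<^sub>v v = l \<cdot>\<^sub>v v"
    unfolding unitary_conj_const[OF assms(1)] using assms(2)
    by (intro eq_vecI) (auto simp: scalar_prod_def if_distrib[of "\<lambda>x. l * x"] if_distrib[of "\<lambda>x. x * _"] cong: if_cong)
  {
    assume "?P *\<^sub>v v = v"
    then have "?D *\<^sub>v v = (?D * ?P) *\<^sub>v v" using car assms(2) by (simp add: assoc_mult_mat_vec[of _ n n _ n])
    also have "?D * ?P = unitary_conj n U (\<lambda>_. l) * ?P"
      by (auto simp: unitary_conj_mult[OF assms(1)] intro!: unitary_conj_cong)
    also have "\<dots> *\<^sub>v v = l \<cdot>\<^sub>v v"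
      using car assms(2) l \<open>?P *\<^sub>v v = v\<close> by (simp add: assoc_mult_mat_vec[of _ n n _ n])
    finally show "?D *\<^sub>v v = l \<cdot>\<^sub>v v" .
  }
  {
    assume D: "?D *\<^sub>v v = l \<cdot>\<^sub>v v"
    have "1\<^sub>m n - ?P = unitary_conj n U (\<lambda>_. 1) - ?P"
      by (simp add: unitary_conj_one[OF assms(1)])
    also have "\<dots> = R * (?D - unitary_conj n U (\<lambda>_. l))"
      using U(1) by (auto simp: R_def unitary_conj_diff unitary_conj_mult[OF assms(1)] intro!: unitary_conj_cong)
    finally have "(1\<^sub>m n - ?P) *\<^sub>v v = R *\<^sub>v ((?D - unitary_conj n U (\<lambda>_. l)) *\<^sub>v v)"
      using car assms(2) by (simp add: assoc_mult_mat_vec[of _ n n _ n] minus_carrier_mat)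
    also have "(?D - unitary_conj n U (\<lambda>_. l)) *\<^sub>v v = 0\<^sub>v n"
      using car assms(2) D l by (simp add: minus_mult_distrib_mat_vec[of _ n n])
    also have "R *\<^sub>v 0\<^sub>v n = 0\<^sub>v n" using car by (intro eq_vecI) auto
    finally have 0: "v - ?P *\<^sub>v v = 0\<^sub>v n"
      using car assms(2) by (simp add: minus_mult_distrib_mat_vec[of _ n n])
    have Pv: "?P *\<^sub>v v \<in> carrier_vec n" using car(2) assms(2) by (rule mult_mat_vec_carrier)
    show "?P *\<^sub>v v = v"
    proof (rule eq_vecI)
      fix i assume "i < dim_vec v"
      then show "(?P *\<^sub>v v) $ i = v $ i"
        using arg_cong[OF 0, of "\<lambda>x. x $ i"] carrier_vecD[OF Pv] carrier_vecD[OF assms(2)]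
        by (simp del: index_mult_mat_vec)
    qed (use carrier_vecD[OF Pv] carrier_vecD[OF assms(2)] in simp)
  }
qed

subsection \<open>Orthogonal projectors, entrywise norms and the Fourier ratio\<close>

lemma scalar_prod_adjoint:
  assumes "A \<in> carrier_mat n n" "x \<in> carrier_vec n" "w \<in> carrier_vec n"
  shows "x \<bullet>c (A *\<^sub>v w) = (mat_adjoint A *\<^sub>v x) \<bullet>c (w :: complex vec)"
proof -
  have "x \<bullet>c (A *\<^sub>v w) = (\<Sum>i<n. \<Sum>j<n. x $ i * cnj (A $$ (i, j)) * cnj (w $ j))"
    using assms by (simp add: scalar_prod_def atLeast0LessThan sum_distrib_left mult_ac)
  also have "\<dots> = (\<Sum>j<n. \<Sum>i<n. x $ i * cnj (A $$ (i, j)) * cnj (w $ j))" by (rule sum.swap)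
  also have "\<dots> = (mat_adjoint A *\<^sub>v x) \<bullet>c w"
    using assms by (simp add: scalar_prod_def atLeast0LessThan sum_distrib_left mult_ac)
  finally show ?thesis .
qed

text \<open>The vector \<open>Pv - Qv\<close> lies in \<open>W\<close>, and as the difference of
  \<open>v - Qv\<close> and \<open>v - Pv\<close> it is orthogonal to \<open>W\<close>; hence it is
  orthogonal to itself and vanishes. This justifies the definite description in
  \<open>orth_projector\<close>.\<close>

lemma is_orth_projector_unique:
  assumes "is_orth_projector n W P" "is_orth_projector n W Q" "W \<subseteq> carrier_vec n"
    and minus: "\<And>x y. x \<in> W \<Longrightarrow> y \<in> W \<Longrightarrow> x - y \<in> W"
  shows "P = Q"
proof -
  have PQ: "P \<in> carrier_mat n n" "Q \<in> carrier_mat n n" using assms by (auto simp: is_orth_projector_def)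
  have eq: "P *\<^sub>v v = Q *\<^sub>v v" if v: "v \<in> carrier_vec n" for v
  proof -
    let ?x = "P *\<^sub>v v - Q *\<^sub>v v"
    have c: "P *\<^sub>v v \<in> carrier_vec n" "Q *\<^sub>v v \<in> carrier_vec n" "?x \<in> carrier_vec n" using PQ v by auto
    have xW: "?x \<in> W" using assms(1,2) v minus by (auto simp: is_orth_projector_def)
    then have "(v - P *\<^sub>v v) \<bullet>c ?x = 0" "(v - Q *\<^sub>v v) \<bullet>c ?x = 0"
      using assms(1,2) v by (auto simp: is_orth_projector_def)
    moreover have "a - b = (v - b) - (v - a)" if "a \<in> carrier_vec n" "b \<in> carrier_vec n" for a b :: "complex vec"
      using that v by (intro eq_vecI) auto
    note this[OF c(1,2)]
    ultimately have "?x \<bullet>c ?x = 0"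
      using c v minus_scalar_prod_distrib[of "v - Q *\<^sub>v v" n "v - P *\<^sub>v v" "conjugate ?x"] by simp
    then have "?x = 0\<^sub>v n" using c conjugate_square_eq_0_vec by blast
    moreover have "a = b" if "a - b = 0\<^sub>v n" "a \<in> carrier_vec n" "b \<in> carrier_vec n" for a b :: "complex vec"
    proof (rule eq_vecI)
      fix i assume "i < dim_vec b"
      then show "a $ i = b $ i" using arg_cong[OF that(1), of "\<lambda>x. x $ i"] that(2,3) by simp
    qed (use that in simp)
    ultimately show ?thesis using c(1,2) by blast
  qed
  show ?thesis
  proof (rule eq_matI)
    fix i j assume "i < dim_row Q" "j < dim_col Q"
    then have ij: "i < n" "j < n" using PQ by auto
    then show "P $$ (i, j) = Q $$ (i, j)"
      using arg_cong[OF eq[of "unit_vec n j"], of "\<lambda>x. x $ i"] PQ by simp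
  qed (use PQ in auto)
qed

text \<open>The spectral projector is Hermitian and idempotent, and its fixed vectors are the
  eigenspace; these properties characterize the orthogonal projector.\<close>

lemma orth_projector_eigenspace:
  assumes "unitary_mat n U"
  shows "orth_projector n (eigenspace (unitary_conj n U d) l)
    = unitary_conj n U (\<lambda>i. if d i = l then 1 else 0)" (is "orth_projector n ?W = ?P")
proof -
  note U = unitary_matD[OF assms]
  have P: "?P \<in> carrier_mat n n" using U by simp
  have W: "v \<in> ?W \<longleftrightarrow> v \<in> carrier_vec n \<and> ?P *\<^sub>v v = v" for v
    using unitary_conj_mult_vec_iff[OF assms, of v d l] carrier_matD[OF unitary_conj_carrier[OF U(1)]]
    by (auto simp: eigenspace_def)
  have PP: "?P * ?P = ?P" by (auto simp: unitary_conj_mult[OF assms] intro!: unitary_conj_cong)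
  have aP: "mat_adjoint ?P = ?P" by (auto simp: unitary_conj_adjoint[OF U(1)] intro!: unitary_conj_cong)
  have PPv: "?P *\<^sub>v (?P *\<^sub>v v) = ?P *\<^sub>v v" if "v \<in> carrier_vec n" for v
    using assoc_mult_mat_vec[OF P P that] PP by simp
  have "is_orth_projector n ?W ?P" unfolding is_orth_projector_def
  proof (intro conjI ballI P)
    fix v :: "complex vec" assume v: "v \<in> carrier_vec n"
    have Pv: "?P *\<^sub>v v \<in> carrier_vec n" using P v by simp
    then show "?P *\<^sub>v v \<in> ?W" using PPv[OF v] W by blast
    fix w assume "w \<in> ?W"
    then have w: "w \<in> carrier_vec n" "?P *\<^sub>v w = w" using W by auto
    \<comment> \<open>Since \<open>w\<close> is fixed by \<open>?P\<close>, the projector can be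
      moved to the left factor, where it annihilates \<open>v - ?P v\<close>.\<close>
    have "(v - ?P *\<^sub>v v) \<bullet>c w = (v - ?P *\<^sub>v v) \<bullet>c (?P *\<^sub>v w)" using w by simp
    also have "\<dots> = (?P *\<^sub>v (v - ?P *\<^sub>v v)) \<bullet>c w"
      using P v Pv w(1) by (subst scalar_prod_adjoint[of _ n]) (auto simp: aP)
    also have "?P *\<^sub>v (v - ?P *\<^sub>v v) = 0\<^sub>v n"
      using P v Pv by (simp add: mult_minus_distrib_mat_vec[of _ n n] PPv)
    finally show "(v - ?P *\<^sub>v v) \<bullet>c w = 0" using w(1) by simp
  qed
  moreover have "x - y \<in> ?W" if "x \<in> ?W" "y \<in> ?W" for x y
    using that P unfolding W by (simp add: mult_minus_distrib_mat_vec[of _ n n])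
  moreover have "?W \<subseteq> carrier_vec n" using W by blast
  ultimately show ?thesis unfolding orth_projector_def
    by (intro the_equality) (auto intro: is_orth_projector_unique)
qed

section \<open>The entrywise norm compared with the trace and the trace norm\<close>

lemma trace_le_entrywise_l1_norm:
  assumes "M \<in> carrier_mat n n"
  shows "cmod (\<Sum>i<n. M $$ (i, i)) \<le> entrywise_l1_norm M"
proof -
  have "cmod (\<Sum>i<n. M $$ (i, i)) \<le> (\<Sum>i<n. cmod (M $$ (i, i)))" by (rule norm_sum)
  also have "\<dots> \<le> (\<Sum>i<n. \<Sum>j<n. cmod (M $$ (i, j)))"
    by (intro sum_mono member_le_sum) auto
  finally show ?thesis using assms by (simp add: entrywise_l1_norm_def)
qed

text \<open>The trace norm is \<open>tr (B * S)\<close>, which is at most the sum of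
  \<open>|B_ab| |S_ba|\<close> and so at most the entrywise norm. Under \<open>le\<close> all of
  these agree, so \<open>|S_ba| = 1\<close> wherever \<open>B_ab\<close> is nonzero; a column of
  norm 1 has room for only one such entry.\<close>

lemma hermitian_l1_norm_extremal:
  fixes d :: "nat \<Rightarrow> real"
  assumes U: "unitary_mat n U" and B: "B = unitary_conj n U (\<lambda>k. complex_of_real (d k))"
    and le: "entrywise_l1_norm B \<le> (\<Sum>k<n. \<bar>d k\<bar>)"
    and ij: "i < n" "j < n" "k < n" "B $$ (i, j) \<noteq> 0" "B $$ (i, k) \<noteq> 0"
  shows "j = k"
proof (rule ccontr)
  assume "j \<noteq> k"
  note UD = unitary_matD[OF U]
  \<comment> \<open>The unitary polar factor of \<open>B\<close>, with the sign of \<open>0\<close> taken to be \<open>1\<close>.\<close>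
  define S where "S = unitary_conj n U (\<lambda>k. if d k \<ge> 0 then 1 else -1)"
  have S: "S \<in> carrier_mat n n" and Bc: "B \<in> carrier_mat n n" using UD by (auto simp: S_def B)
  have aS: "mat_adjoint S = S"
    by (auto simp: S_def unitary_conj_adjoint[OF UD(1)] intro!: unitary_conj_cong)
  have "S * S = unitary_conj n U (\<lambda>_. 1)"
    by (auto simp: S_def unitary_conj_mult[OF U] intro!: unitary_conj_cong)
  then have SS: "mat_adjoint S * S = 1\<^sub>m n" by (simp add: aS unitary_conj_one[OF U])
  have col: "(\<Sum>a<n. (cmod (S $$ (a, b)))\<^sup>2) = 1" if b: "b < n" for b
  proof -
    have "complex_of_real (\<Sum>a<n. (cmod (S $$ (a, b)))\<^sup>2) = (mat_adjoint S * S) $$ (b, b)"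
      using S b by (simp add: scalar_prod_def atLeast0LessThan complex_norm_square mult.commute del: of_real_power)
    also have "\<dots> = complex_of_real 1" unfolding SS using b by simp
    finally show ?thesis unfolding of_real_eq_iff .
  qed
  have S1: "cmod (S $$ (a, b)) \<le> 1" if "a < n" "b < n" for a b
  proof -
    have "(cmod (S $$ (a, b)))\<^sup>2 \<le> (\<Sum>a<n. (cmod (S $$ (a, b)))\<^sup>2)"
      using that by (intro member_le_sum) auto
    then show ?thesis using col that abs_square_le_1[of "cmod (S $$ (a, b))"] by simp
  qed
  have "complex_of_real (\<Sum>k<n. \<bar>d k\<bar>) = (\<Sum>a<n. (B * S) $$ (a, a))"
    unfolding S_def B unitary_conj_mult[OF U] unitary_conj_trace[OF U] of_real_sum
    by (intro sum.cong) auto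
  also have "\<dots> = (\<Sum>a<n. \<Sum>b<n. B $$ (a, b) * S $$ (b, a))"
    using S Bc by (simp add: scalar_prod_def atLeast0LessThan)
  finally have tr: "complex_of_real (\<Sum>k<n. \<bar>d k\<bar>) = (\<Sum>a<n. \<Sum>b<n. B $$ (a, b) * S $$ (b, a))" .
  have "(\<Sum>k<n. \<bar>d k\<bar>) = Re (\<Sum>a<n. \<Sum>b<n. B $$ (a, b) * S $$ (b, a))"
    unfolding tr[symmetric] by (simp only: Re_complex_of_real)
  also have "\<dots> = (\<Sum>a<n. \<Sum>b<n. Re (B $$ (a, b) * S $$ (b, a)))"
    by (simp only: Re_sum)
  also have "\<dots> \<le> (\<Sum>a<n. \<Sum>b<n. cmod (B $$ (a, b)) * cmod (S $$ (b, a)))"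
    by (intro sum_mono) (metis complex_Re_le_cmod norm_mult)
  \<comment> \<open>The total slack in the bound \<open>|S_ba| \<le> 1\<close>, weighted by
    \<open>|B_ab|\<close>. Each summand is nonnegative, so each must vanish.\<close>
  finally have "(\<Sum>a<n. \<Sum>b<n. cmod (B $$ (a, b)) * (1 - cmod (S $$ (b, a)))) \<le> 0"
    using le Bc by (simp add: entrywise_l1_norm_def algebra_simps sum_subtractf)
  moreover have nn: "cmod (B $$ (a, b)) * (1 - cmod (S $$ (b, a))) \<ge> 0" if "a < n" "b < n" for a b
    using S1 that by simp
  ultimately have "(\<Sum>a<n. \<Sum>b<n. cmod (B $$ (a, b)) * (1 - cmod (S $$ (b, a)))) = 0"
    by (intro antisym sum_nonneg) auto
  then have "(\<Sum>b<n. cmod (B $$ (i, b)) * (1 - cmod (S $$ (b, i)))) = 0"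
    using ij(1) nn by (subst (asm) sum_nonneg_eq_0_iff) (auto intro!: sum_nonneg)
  then have z: "cmod (B $$ (i, b)) * (1 - cmod (S $$ (b, i))) = 0" if "b < n" for b
    using ij(1) nn that by (subst (asm) sum_nonneg_eq_0_iff) auto
  have "cmod (S $$ (j, i)) = 1" "cmod (S $$ (k, i)) = 1" using z[of j] z[of k] ij by auto
  \<comment> \<open>Two entries of modulus 1 in column \<open>i\<close> of \<open>S\<close> would
    give that column squared norm at least 2.\<close>
  then have "2 = (\<Sum>a\<in>{j, k}. (cmod (S $$ (a, i)))\<^sup>2)" using \<open>j \<noteq> k\<close> by simp
  also have "\<dots> \<le> (\<Sum>a<n. (cmod (S $$ (a, i)))\<^sup>2)" using ij by (intro sum_mono2) auto
  finally show False using col[OF ij(1)] by simp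
qed

section \<open>The Fourier matrix and the Fourier ratio\<close>

text \<open>For \<open>j \<noteq> k\<close> this is a geometric sum whose ratio \<open>z\<close>
  satisfies \<open>z ^ n = 1\<close> but \<open>z \<noteq> 1\<close>: otherwise \<open>n\<close>
  would divide \<open>j - k\<close>, whose absolute value is less than \<open>n\<close>.\<close>

lemma sum_roots_of_unity:
  assumes "j < n" "k < n"
  shows "(\<Sum>x<n. exp (2 * of_real pi * \<i> * (of_nat j - of_nat k) * of_nat x / of_nat n))
    = (if j = k then of_nat n else (0 :: complex))"
proof (cases "j = k")
  case False
  define z :: complex where "z = exp (2 * of_real pi * \<i> * (of_nat j - of_nat k) / of_nat n)"
  have n: "n > 0" using assms by simp
  have "z \<noteq> 1"
  proof
    assume "z = 1"
    then obtain m :: int where "2 * pi * (real j - real k) / real n = of_int (2 * m) * pi"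
      unfolding z_def exp_eq_1 by auto
    then have "pi * (real j - real k) = pi * (of_int m * real n)" using n by (simp add: field_simps)
    then have "real j - real k = of_int m * real n" unfolding mult_cancel_left by simp
    then have eq: "int j - int k = m * int n"
      by (metis (mono_tags, opaque_lifting) of_int_diff of_int_eq_iff of_int_mult of_int_of_nat_eq)
    have "\<bar>int j - int k\<bar> < int n" using assms by simp
    then have "m = 0" unfolding eq using n by (simp add: abs_mult)
    then show False using eq False by simp
  qed
  moreover have "z ^ n = 1"
  proof -
    have "z ^ n = exp (2 * of_real pi * \<i> * (of_int (int j - int k)))"
      using n by (simp add: z_def flip: exp_of_nat_mult)
    moreover have "exp (2 * complex_of_real pi * \<i> * of_int m) = 1"
      for m :: int unfolding exp_eq_1 by (intro conjI exI[of _ m]) auto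
    from this[of "int j - int k"]
    have "exp (2 * complex_of_real pi * \<i> * (of_nat j - of_nat k)) = 1" by simp
    ultimately show ?thesis by simp
  qed
  moreover have "exp (2 * of_real pi * \<i> * (of_nat j - of_nat k) * of_nat x / of_nat n) = z ^ x" for x
    by (simp add: z_def field_simps flip: exp_of_nat_mult)
  ultimately show ?thesis using False by (simp add: geometric_sum)
qed simp

lemma fourier_mat_carrier [simp]: "fourier_mat n \<in> carrier_mat n n"
  by (simp add: fourier_mat_def)

lemma unitary_fourier_mat: "unitary_mat n (fourier_mat n)"
proof (rule unitary_matI)
  show "mat_adjoint (fourier_mat n) * fourier_mat n = 1\<^sub>m n"
  proof (rule eq_matI)
    fix i j assume "i < dim_row (1\<^sub>m n :: complex mat)" "j < dim_col (1\<^sub>m n :: complex mat)"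
    then have ij: "i < n" "j < n" by auto
    have sq: "complex_of_real (sqrt (real n)) * complex_of_real (sqrt (real n)) = of_nat n"
      by (simp flip: of_real_mult)
    have "(mat_adjoint (fourier_mat n) * fourier_mat n) $$ (i, j)
      = (\<Sum>x<n. cnj (fourier_mat n $$ (x, i)) * fourier_mat n $$ (x, j))"
      using ij by (simp add: scalar_prod_def atLeast0LessThan carrier_matD[OF fourier_mat_carrier])
    also have "\<dots> = (\<Sum>x<n. exp (2 * of_real pi * \<i> * (of_nat i - of_nat j) * of_nat x / of_nat n) / of_nat n)"
      using ij by (intro sum.cong)
        (auto simp: fourier_mat_def sq exp_cnj algebra_simps diff_divide_distrib simp flip: exp_add)
    also have "\<dots> = 1\<^sub>m n $$ (i, j)"
      using ij by (simp add: sum_roots_of_unity flip: sum_divide_distrib)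
    finally show "(mat_adjoint (fourier_mat n) * fourier_mat n) $$ (i, j) = 1\<^sub>m n $$ (i, j)" .
  qed (auto simp: carrier_matD[OF fourier_mat_carrier])
qed simp

lemma mult_mat_index_sum:
  assumes "A \<in> carrier_mat m n" "B \<in> carrier_mat n k" "i < m" "j < k"
  shows "(A * B) $$ (i, j) = (\<Sum>x<n. A $$ (i, x) * B $$ (x, j))"
  using assms by (simp add: scalar_prod_def atLeast0LessThan)

text \<open>The adjoint of the Fourier matrix arises from it by the column permutation
  \<open>j \<mapsto> -j\<close> modulo \<open>n\<close>, which changes neither norm. The ratio can
  then be read off a unitary conjugate of \<open>M\<close>, to which spectral arguments
  apply.\<close>

lemma fourier_ratio_eq_adjoint:
  assumes M: "M \<in> carrier_mat n n"
  defines "X \<equiv> fourier_mat n * M * mat_adjoint (fourier_mat n)"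
  shows "fourier_ratio M = entrywise_l1_norm X / frobenius_norm X"
proof -
  let ?F = "fourier_mat n"
  \<comment> \<open>Negation modulo \<open>n\<close>; the reduction matters at \<open>j = 0\<close>,
    where \<open>n - j\<close> is out of range.\<close>
  let ?p = "\<lambda>j. (n - j) mod n"
  have bij: "bij_betw ?p {..<n} {..<n}"
    by (rule bij_betw_byWitness[where f' = ?p])
       (auto simp: mod_if split: if_splits)
  have F: "?F $$ (x, ?p j) = mat_adjoint ?F $$ (x, j)" if "x < n" "j < n" for x j
  proof (cases "j = 0")
    case True
    then show ?thesis using that by (simp add: fourier_mat_def)
  next
    case False
    \<comment> \<open>The two exponents differ by an integer multiple of
      \<open>2 \<pi> \<i>\<close>.\<close>
    have "- 2 * complex_of_real pi * \<i> * of_nat x * of_nat (n - j) / of_nat n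
      = 2 * complex_of_real pi * \<i> * of_nat x * of_nat j / of_nat n + of_int (2 * - int x) * of_real pi * \<i>"
      using that by (simp add: of_nat_diff field_simps)
    then have "exp (- 2 * complex_of_real pi * \<i> * of_nat x * of_nat (n - j) / of_nat n)
      = exp (2 * complex_of_real pi * \<i> * of_nat x * of_nat j / of_nat n)"
      unfolding exp_eq by (intro exI[of _ "- int x"]) simp
    then show ?thesis using that False by (simp add: fourier_mat_def exp_cnj mult_ac)
  qed
  have FM: "?F * M \<in> carrier_mat n n" using M by (intro mult_carrier_mat[of _ n n]) auto
  have Xc: "X \<in> carrier_mat n n" "?F * M * ?F \<in> carrier_mat n n"
    unfolding X_def by (intro mult_carrier_mat[OF FM]; simp)+
  have idx: "(?F * M * ?F) $$ (i, ?p j) = X $$ (i, j)" if ij: "i < n" "j < n" for i j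
  proof -
    have "?p j < n" using ij by simp
    then have "(?F * M * ?F) $$ (i, ?p j) = (\<Sum>x<n. (?F * M) $$ (i, x) * ?F $$ (x, ?p j))"
      by (intro mult_mat_index_sum[OF FM fourier_mat_carrier ij(1)])
    also have "\<dots> = (\<Sum>x<n. (?F * M) $$ (i, x) * mat_adjoint ?F $$ (x, j))"
      using ij by (intro sum.cong) (auto simp: F)
    also have "\<dots> = X $$ (i, j)"
      unfolding X_def
      by (intro mult_mat_index_sum[OF FM mat_adjoint_carrier[OF fourier_mat_carrier] ij, symmetric])
    finally show ?thesis .
  qed
  have "(\<Sum>j<n. f ((?F * M * ?F) $$ (i, j))) = (\<Sum>j<n. f (X $$ (i, j)))" if "i < n" for i and f :: "complex \<Rightarrow> real"
    using that sum.reindex_bij_betw[OF bij, of "\<lambda>j. f ((?F * M * ?F) $$ (i, j))"] idx by simp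
  note row = this[of _ cmod] this[of _ "\<lambda>z. (cmod z)\<^sup>2"]
  have dims: "dim_row X = n" "dim_col X = n" "dim_row (?F * M * ?F) = n" "dim_col (?F * M * ?F) = n"
    using Xc by auto
  have "entrywise_l1_norm (?F * M * ?F) = entrywise_l1_norm X"
    unfolding entrywise_l1_norm_def dims by (rule sum.cong[OF refl], rule row(1), simp)
  moreover have "frobenius_norm (?F * M * ?F) = frobenius_norm X"
    unfolding frobenius_norm_def dims
    by (rule arg_cong[where f = sqrt], rule sum.cong[OF refl], rule row(2), simp)
  ultimately show ?thesis using M by (simp add: fourier_ratio_def)
qed

section \<open>Fourier ratios of spectral projectors\<close>

text \<open>In the Fourier basis the projector keeps its eigenvalues 0 and 1, so its trace is
  \<open>?m\<close>, a lower bound for the entrywise norm, and its Frobenius norm is the square root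
  of \<open>?m\<close>.\<close>

lemma sqrt_card_le_fourier_ratio:
  assumes "unitary_mat n U"
  shows "sqrt (real (card {i. i < n \<and> P i})) \<le> fourier_ratio (unitary_conj n U (\<lambda>i. if P i then 1 else 0))"
    (is "sqrt (real ?m) \<le> fourier_ratio ?M")
proof -
  note F = unitary_fourier_mat[of n]
  let ?X = "unitary_conj n (fourier_mat n * U) (\<lambda>i. if P i then 1 else 0)"
  note FU = unitary_mat_mult[OF F assms]
  have X: "?X \<in> carrier_mat n n" using unitary_matD(1)[OF FU] by simp
  have set: "{..<n} \<inter> {i. P i} = {i. i < n \<and> P i}" by auto
  have "frobenius_norm ?X = sqrt (real ?m)"
    unfolding unitary_conj_frobenius[OF FU] by (simp add: if_distrib[of cmod] if_distrib[of "\<lambda>x. x\<^sup>2"] sum.If_cases set)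
  moreover have "real ?m \<le> entrywise_l1_norm ?X"
    using trace_le_entrywise_l1_norm[OF X] by (simp add: unitary_conj_trace[OF FU] sum.If_cases set)
  ultimately have "real ?m / sqrt (real ?m) \<le> entrywise_l1_norm ?X / frobenius_norm ?X"
    by (simp add: divide_right_mono)
  also have "\<dots> = fourier_ratio ?M"
    using unitary_matD(1)[OF assms] by (simp add: fourier_ratio_eq_adjoint[of _ n] unitary_conj_conj[OF F assms])
  \<comment> \<open>This includes \<open>?m = 0\<close>, where the quotient \<open>0 / 0\<close> is
    0.\<close>
  finally show ?thesis by (simp add: real_div_sqrt)
qed

lemma sqrt_multiplicity_le_fourier_ratio:
  assumes "A \<in> carrier_mat n n" "mat_adjoint A = A"
  shows "sqrt (real (multiplicity_eigenvalue A l)) \<le> fourier_ratio (orth_projector n (eigenspace A l))"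
proof -
  obtain U d where U: "unitary_mat n U" and A: "A = unitary_conj n U (\<lambda>i. complex_of_real (d i))"
    by (rule hermitian_spectral[OF assms])
  show ?thesis
    unfolding A orth_projector_eigenspace[OF U] order_unitary_conj[OF U]
    by (rule sqrt_card_le_fourier_ratio[OF U])
qed

text \<open>Shows that the spectral projector \<open>X\<close> of \<open>B\<close> for
  \<open>\<mu>\<close> is a 0-1 diagonal matrix; its entrywise norm is then its rank and its
  Frobenius norm the square root of the rank.\<close>

lemma fourier_ratio_eigenprojector:
  fixes A :: "complex mat"
  assumes A: "A \<in> carrier_mat n n" "mat_adjoint A = A"
  defines "B \<equiv> fourier_mat n * A * mat_adjoint (fourier_mat n)"
  assumes sparse: "\<And>i j k. \<lbrakk>i < n; j < n; k < n; B $$ (i, j) \<noteq> 0; B $$ (i, k) \<noteq> 0\<rbrakk> \<Longrightarrow> j = k"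
    and off: "\<And>i j. \<lbrakk>i < n; j < n; i \<noteq> j; B $$ (i, j) \<noteq> 0\<rbrakk> \<Longrightarrow> cmod \<mu> \<noteq> cmod (B $$ (i, j))"
  shows "fourier_ratio (orth_projector n (eigenspace A \<mu>)) = sqrt (real (multiplicity_eigenvalue A \<mu>))"
proof -
  obtain U d where U: "unitary_mat n U" and Ad: "A = unitary_conj n U (\<lambda>i. complex_of_real (d i))"
    by (rule hermitian_spectral[OF A])
  note F = unitary_fourier_mat[of n]
  define W where "W = fourier_mat n * U"
  have W: "unitary_mat n W" unfolding W_def by (rule unitary_mat_mult[OF F U])
  note WD = unitary_matD[OF W]
  have Bd: "B = unitary_conj n W (\<lambda>i. complex_of_real (d i))"
    unfolding B_def Ad W_def by (rule unitary_conj_conj[OF F U])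
  let ?e = "\<lambda>i. if complex_of_real (d i) = \<mu> then 1 else 0 :: complex"
  define X where "X = unitary_conj n W ?e"
  have BX: "B \<in> carrier_mat n n" "X \<in> carrier_mat n n" using WD(1) by (auto simp: Bd X_def)
  have hB: "B $$ (j, i) = cnj (B $$ (i, j))" if "i < n" "j < n" for i j
  proof -
    have "mat_adjoint B = B" by (simp add: Bd unitary_conj_adjoint[OF WD(1)])
    then show ?thesis using mat_adjoint_index[of j B i] BX that by auto
  qed
  have hX: "X $$ (j, i) = cnj (X $$ (i, j))" if "i < n" "j < n" for i j
  proof -
    have "mat_adjoint X = X"
      by (auto simp: X_def unitary_conj_adjoint[OF WD(1)] intro!: unitary_conj_cong)
    then show ?thesis using mat_adjoint_index[of j X i] BX that by auto
  qed
  \<comment> \<open>Every column of \<open>X\<close> lies in the \<open>\<mu>\<close>-eigenspace of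
    \<open>B\<close>; by \<open>row\<close>, the left side has at most one nonzero term.\<close>
  have eig: "(\<Sum>k<n. B $$ (i, k) * X $$ (k, j)) = \<mu> * X $$ (i, j)" if "i < n" "j < n" for i j
  proof -
    have "B * X = unitary_conj n W (\<lambda>_. \<mu>) * X"
      by (auto simp: Bd X_def unitary_conj_mult[OF W] intro!: unitary_conj_cong)
    also have "\<dots> = \<mu> \<cdot>\<^sub>m X"
      unfolding unitary_conj_const[OF W] using BX by (simp add: mult_smult_assoc_mat[of _ n n _ n])
    finally have "(B * X) $$ (i, j) = \<mu> * X $$ (i, j)" using BX that by simp
    then show ?thesis using BX that by (simp add: scalar_prod_def atLeast0LessThan)
  qed
  have row: "(\<Sum>k<n. B $$ (i, k) * X $$ (k, j)) = B $$ (i, k) * X $$ (k, j)"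
    if "i < n" "k < n" "B $$ (i, k) \<noteq> 0" for i j k
  proof -
    have "(\<Sum>k'<n. B $$ (i, k') * X $$ (k', j)) = (\<Sum>k'\<in>{k}. B $$ (i, k') * X $$ (k', j))"
      using that sparse by (intro sum.mono_neutral_right) auto
    then show ?thesis by simp
  qed
  \<comment> \<open>The coordinates whose unit vector is an eigenvector of \<open>B\<close> for
    \<open>\<mu>\<close>; they turn out to be the support of the diagonal of
    \<open>X\<close>.\<close>
  define S where "S = {i. i < n \<and> B $$ (i, i) = \<mu> \<and> (\<forall>k<n. k \<noteq> i \<longrightarrow> B $$ (i, k) = 0)}"
  have X0: "X $$ (i, j) = 0" if ij: "i < n" "j < n" and S: "i \<notin> S" for i j
  proof (rule ccontr)
    assume nz: "X $$ (i, j) \<noteq> 0"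
    show False
    proof (cases "\<exists>k<n. B $$ (i, k) \<noteq> 0")
      case False
      \<comment> \<open>A zero row forces \<open>\<mu> = 0\<close>, and then \<open>i\<close>
        belongs to \<open>S\<close> after all.\<close>
      then have "\<mu> = 0" using eig[OF ij] nz by auto
      then show False using False S ij by (auto simp: S_def)
    next
      case True
      then obtain k where k: "k < n" "B $$ (i, k) \<noteq> 0" by blast
      have 1: "B $$ (i, k) * X $$ (k, j) = \<mu> * X $$ (i, j)" using eig[OF ij] row[OF ij(1) k] by simp
      show False
      proof (cases "k = i")
        case True
        then have "B $$ (i, i) = \<mu>" using 1 nz by simp
        moreover have "B $$ (i, k') = 0" if "k' < n" "k' \<noteq> i" for k'
          using sparse[of i i k'] k True that ij by auto
        ultimately show False using S ij by (auto simp: S_def)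
      next
        case False
        \<comment> \<open>Rows \<open>i\<close> and \<open>k\<close> form a block with zero
          diagonal. Combining its two eigenvector equations gives \<open>\<mu>\<close> squared as
          \<open>|B_ik|\<close> squared, which \<open>off\<close> excludes.\<close>
        have Bk: "B $$ (k, i) = cnj (B $$ (i, k))" by (rule hB[OF ij(1) k(1)])
        have "B $$ (k, i) * X $$ (i, j) = \<mu> * X $$ (k, j)"
          using eig[OF k(1) ij(2)] row[OF k(1) ij(1)] k Bk by simp
        then have "B $$ (i, k) * B $$ (k, i) * X $$ (i, j) = \<mu> * \<mu> * X $$ (i, j)"
          using 1 by (metis mult.assoc mult.left_commute)
        then have "\<mu> * \<mu> = B $$ (i, k) * cnj (B $$ (i, k))" using nz Bk by simp
        then have "(cmod \<mu>)\<^sup>2 = (cmod (B $$ (i, k)))\<^sup>2"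
          by (metis complex_mod_cnj norm_mult power2_eq_square)
        then have "cmod \<mu> = cmod (B $$ (i, k))" by (simp add: power2_eq_iff_nonneg)
        then show False using off[OF ij(1) k(1)] False k(2) by simp
      qed
    qed
  qed
  have X1: "X $$ (k, i) = (if k = i then 1 else 0)" if k: "k < n" and i: "i \<in> S" for k i
  proof -
    have i': "i < n" using i by (simp add: S_def)
    have "B $$ (k, i) = (if k = i then \<mu> else 0)" if "k < n" for k
      using that i hB[OF i' that] by (auto simp: S_def)
    then have "B *\<^sub>v unit_vec n i = \<mu> \<cdot>\<^sub>v unit_vec n i"
      using BX i' by (intro eq_vecI) auto
    then have "X *\<^sub>v unit_vec n i = unit_vec n i"
      unfolding Bd X_def using unitary_conj_mult_vec_iff[OF W] by simp
    then have "(X *\<^sub>v unit_vec n i) $ k = unit_vec n i $ k" by simp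
    then show ?thesis using BX k i' by simp
  qed
  \<comment> \<open>Rows outside \<open>S\<close> vanish by \<open>X0\<close>. Columns in
    \<open>S\<close> are unit vectors by \<open>X1\<close>, and Hermitian symmetry transfers this to
    the rows.\<close>
  have X: "X $$ (i, j) = (if i = j \<and> i \<in> S then 1 else 0)" if "i < n" "j < n" for i j
  proof (cases "i \<in> S")
    case True
    then show ?thesis using hX[OF that(2,1)] X1[OF that(2) True] by auto
  qed (use X0[OF that] in simp)
  have S: "S \<subseteq> {..<n}" by (auto simp: S_def)
  have one: "(\<Sum>i<n. \<Sum>j<n. if i = j \<and> i \<in> S then 1 else 0) = real (card S)"
  proof -
    have "(\<Sum>i<n. \<Sum>j<n. if i = j \<and> i \<in> S then 1 else 0 :: real) = (\<Sum>i<n. if i \<in> S then 1 else 0)"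
      by (intro sum.cong refl) (simp add: sum.delta)
    then show ?thesis using S by (simp add: sum.If_cases Int_absorb1)
  qed
  have l1: "entrywise_l1_norm X = real (card S)"
    unfolding one[symmetric] using BX by (auto simp: entrywise_l1_norm_def X intro!: sum.cong)
  have fr: "frobenius_norm X = sqrt (real (card S))"
    unfolding one[symmetric] frobenius_norm_def using BX
    by (auto simp: X intro!: sum.cong arg_cong[where f = sqrt])
  have set: "{..<n} \<inter> {i. complex_of_real (d i) = \<mu>} = {i. i < n \<and> complex_of_real (d i) = \<mu>}" by auto
  \<comment> \<open>A second evaluation of the Frobenius norm, now from the eigenvalues; comparison
    with \<open>fr\<close> shows that \<open>S\<close> has as many elements as the multiplicity of
    \<open>\<mu>\<close>.\<close>
  have "frobenius_norm X = sqrt (real (multiplicity_eigenvalue A \<mu>))"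
    unfolding X_def unitary_conj_frobenius[OF W] Ad order_unitary_conj[OF U]
    by (simp add: if_distrib[of cmod] if_distrib[of "\<lambda>x. x\<^sup>2"] sum.If_cases set)
  then have "real (card S) = real (multiplicity_eigenvalue A \<mu>)" using fr by simp
  moreover have "fourier_ratio (orth_projector n (eigenspace A \<mu>)) = entrywise_l1_norm X / frobenius_norm X"
    unfolding Ad orth_projector_eigenspace[OF U] X_def W_def
    using unitary_matD(1)[OF U] by (simp add: fourier_ratio_eq_adjoint[of _ n] unitary_conj_conj[OF F U])
  ultimately show ?thesis by (simp add: l1 fr real_div_sqrt)
qed

subsection \<open>Graphs\<close>

text \<open>The spectrum is the image of \<open>d\<close> and each multiplicity is the size of a
  fibre, so grouping the sum over \<open>k\<close> by fibres gives the energy.\<close>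

lemma mat_energy_unitary_conj:
  assumes "unitary_mat n U"
  shows "mat_energy (unitary_conj n U d) = (\<Sum>k<n. cmod (d k))"
proof -
  let ?A = "unitary_conj n U d"
  have A: "?A \<in> carrier_mat n n" using unitary_matD(1)[OF assms] by simp
  have "char_poly ?A \<noteq> 0" using degree_monic_char_poly[OF A] by auto
  then have "poly (char_poly ?A) l = 0 \<longleftrightarrow> Polynomial.order l (char_poly ?A) \<noteq> 0" for l
    by (simp add: order_root)
  then have "l \<in> spectrum ?A \<longleftrightarrow> {i. i < n \<and> d i = l} \<noteq> {}" for l
    by (simp add: spectrum_def eigenvalue_root_char_poly[OF A] order_unitary_conj[OF assms])
  then have "spectrum ?A = d ` {..<n}" by auto
  then have "mat_energy ?A = (\<Sum>l\<in>d ` {..<n}. real (card {i. i < n \<and> d i = l}) * cmod l)"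
    by (simp add: mat_energy_def order_unitary_conj[OF assms])
  also have "\<dots> = (\<Sum>l\<in>d ` {..<n}. \<Sum>k\<in>{i \<in> {..<n}. d i = l}. cmod (d k))"
    by (intro sum.cong refl) simp
  also have "\<dots> = (\<Sum>k<n. cmod (d k))" by (rule sum.image_gen[symmetric]) simp
  finally show ?thesis .
qed

context
  fixes V :: "'a set" and E :: "'a set set" and \<sigma> :: "'a \<Rightarrow> nat"
  assumes G: "simple_graph V E" and L: "labeling V \<sigma>"
begin

private lemma inv_bij: "bij_betw (inv_into V \<sigma>) {..<card V} V"
  using L unfolding labeling_def by (rule bij_betw_inv_into)

lemma adjacency_mat_row_sum:
  assumes "x < card V"
  shows "(\<Sum>y<card V. adjacency_mat V E \<sigma> $$ (x, y)) = of_nat (vertex_degree E (inv_into V \<sigma> x))"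
proof -
  let ?v = "inv_into V \<sigma> x"
  have "(\<Sum>y<card V. adjacency_mat V E \<sigma> $$ (x, y)) = (\<Sum>w\<in>V. if {?v, w} \<in> E then 1 else 0)"
    using assms by (simp add: adjacency_mat_def
        sum.reindex_bij_betw[OF inv_bij, of "\<lambda>w. if {?v, w} \<in> E then 1 else 0", symmetric])
  also have "\<dots> = of_nat (card (V \<inter> {w. {?v, w} \<in> E}))"
    using G by (simp add: simple_graph_def sum.If_cases)
  also have "V \<inter> {w. {?v, w} \<in> E} = {w. {?v, w} \<in> E}"
    using G by (auto simp: simple_graph_def)
  finally show ?thesis by (simp add: vertex_degree_def)
qed

text \<open>The handshake lemma, by double counting incident pairs of a vertex and an edge.\<close>

lemma sum_vertex_degree: "(\<Sum>v\<in>V. vertex_degree E v) = 2 * card E"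
proof -
  have fin: "finite V" "finite E"
    using G finite_subset[of E "Pow V"] by (auto simp: simple_graph_def)
  have "vertex_degree E v = card {e \<in> E. v \<in> e}" for v
  proof -
    have "bij_betw (\<lambda>w. {v, w}) {w. {v, w} \<in> E} {e \<in> E. v \<in> e}"
      unfolding bij_betw_def
    proof (intro conjI equalityI subsetI)
      show "inj_on (\<lambda>w. {v, w}) {w. {v, w} \<in> E}" by (auto simp: inj_on_def doubleton_eq_iff)
      fix e assume e: "e \<in> {e \<in> E. v \<in> e}"
      then have "card e = 2" using G by (auto simp: simple_graph_def)
      then obtain w where "e = {v, w}" using e by (auto simp: card_2_iff)
      then show "e \<in> (\<lambda>w. {v, w}) ` {w. {v, w} \<in> E}" using e by auto
    qed auto
    then show ?thesis unfolding vertex_degree_def by (rule bij_betw_same_card)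
  qed
  then have "(\<Sum>v\<in>V. vertex_degree E v) = (\<Sum>v\<in>V. card {e \<in> E. v \<in> e})" by simp
  also have "\<dots> = (\<Sum>e\<in>E. card {v \<in> V. v \<in> e})"
    using fin by (intro sum_multicount_gen) auto
  also have "\<dots> = (\<Sum>e\<in>E. 2)"
  proof (intro sum.cong refl)
    fix e assume "e \<in> E"
    then have "e \<subseteq> V" "card e = 2" using G by (auto simp: simple_graph_def)
    moreover from this have "{v \<in> V. v \<in> e} = e" by auto
    ultimately show "card {v \<in> V. v \<in> e} = 2" by simp
  qed
  finally show ?thesis by simp
qed

lemma adjacency_mat_total: "(\<Sum>x<card V. \<Sum>y<card V. adjacency_mat V E \<sigma> $$ (x, y)) = of_nat (2 * card E)"
proof -
  have "(\<Sum>x<card V. \<Sum>y<card V. adjacency_mat V E \<sigma> $$ (x, y))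
    = (\<Sum>x<card V. of_nat (vertex_degree E (inv_into V \<sigma> x)))"
    by (intro sum.cong refl adjacency_mat_row_sum) simp
  also have "\<dots> = (\<Sum>v\<in>V. of_nat (vertex_degree E v))" by (rule sum.reindex_bij_betw[OF inv_bij])
  also have "\<dots> = of_nat (2 * card E)" by (simp flip: sum_vertex_degree)
  finally show ?thesis .
qed

text \<open>Entries 0 and 1 equal their squared moduli, so the squared norm is the total of all
  entries. This identifies the denominator in the extremality hypothesis.\<close>

lemma frobenius_norm_adjacency_mat: "frobenius_norm (adjacency_mat V E \<sigma>) = sqrt (2 * real (card E))"
proof -
  let ?A = "adjacency_mat V E \<sigma>"
  have "complex_of_real (\<Sum>x<card V. \<Sum>y<card V. (cmod (?A $$ (x, y)))\<^sup>2)
    = (\<Sum>x<card V. \<Sum>y<card V. ?A $$ (x, y))"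
    unfolding of_real_sum by (intro sum.cong refl) (auto simp: adjacency_mat_def)
  also have "\<dots> = complex_of_real (2 * real (card E))" unfolding adjacency_mat_total by simp
  finally have "(\<Sum>x<card V. \<Sum>y<card V. (cmod (?A $$ (x, y)))\<^sup>2) = 2 * real (card E)"
    unfolding of_real_eq_iff .
  moreover have "dim_row ?A = card V" "dim_col ?A = card V" by (auto simp: adjacency_mat_def)
  ultimately show ?thesis by (simp only: frobenius_norm_def)
qed

end

lemma adjacency_mat_hermitian:
  "adjacency_mat V E \<sigma> \<in> carrier_mat (card V) (card V)"
  "mat_adjoint (adjacency_mat V E \<sigma>) = adjacency_mat V E \<sigma>"
  by (auto simp: adjacency_mat_def insert_commute intro!: eq_matI)

section \<open>Consequences of an extremal labeling\<close>

text \<open>Conjugation by the Fourier matrix preserves the Frobenius norm, so both sides of the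
  hypothesis have the same positive denominator. Cancelling it says that the entrywise norm of
  \<open>B\<close> equals the energy, which is the trace norm of \<open>B\<close>.\<close>

lemma extremal_labeling_sparse:
  assumes "simple_graph V E" "card E > 0" "labeling V \<sigma>"
    and "fourier_ratio (adjacency_mat V E \<sigma>) = graph_energy V E / sqrt (2 * real (card E))"
  defines "F \<equiv> fourier_mat (card V)"
  defines "B \<equiv> F * adjacency_mat V E \<sigma> * mat_adjoint F"
  assumes "i < card V" "j < card V" "k < card V" "B $$ (i, j) \<noteq> 0" "B $$ (i, k) \<noteq> 0"
  shows "j = k"
proof -
  let ?n = "card V" and ?A = "adjacency_mat V E \<sigma>"
  obtain U d where U: "unitary_mat ?n U" and A: "?A = unitary_conj ?n U (\<lambda>k. complex_of_real (d k))"
    by (rule hermitian_spectral[OF adjacency_mat_hermitian])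
  have F: "unitary_mat ?n F" unfolding F_def by (rule unitary_fourier_mat)
  note W = unitary_mat_mult[OF F U]
  have B: "B = unitary_conj ?n (F * U) (\<lambda>k. complex_of_real (d k))"
    unfolding B_def A by (rule unitary_conj_conj[OF F U])
  have "frobenius_norm B = frobenius_norm ?A"
    unfolding A B unitary_conj_frobenius[OF U] unitary_conj_frobenius[OF W] ..
  then have "entrywise_l1_norm B / sqrt (2 * real (card E)) = graph_energy V E / sqrt (2 * real (card E))"
    using assms(4) fourier_ratio_eq_adjoint[OF adjacency_mat_hermitian(1)[of V E \<sigma>]]
      frobenius_norm_adjacency_mat[OF assms(1,3)] by (simp add: B_def F_def)
  then have "entrywise_l1_norm B = graph_energy V E" using assms(2) by simp
  also have "\<dots> = mat_energy ?A" using assms(1,3) by (intro graph_energy_eq) (auto simp: simple_graph_def)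
  also have "\<dots> = (\<Sum>k<?n. \<bar>d k\<bar>)" unfolding A mat_energy_unitary_conj[OF U] by simp
  finally show ?thesis using hermitian_l1_norm_extremal[OF W B] assms(7-) by simp
qed

text \<open>The entry \<open>B_00\<close> is a positive multiple of the sum of all entries of the
  adjacency matrix. By sparsity it is the only nonzero entry in its row, hence in its column, so the
  constant vector is an eigenvector and all row sums agree.\<close>

lemma extremal_labeling_regular:
  assumes "simple_graph V E" "card E > 0" "labeling V \<sigma>"
    and "fourier_ratio (adjacency_mat V E \<sigma>) = graph_energy V E / sqrt (2 * real (card E))"
  obtains a where "\<And>v. v \<in> V \<Longrightarrow> vertex_degree E v = a"
proof -
  let ?n = "card V" and ?A = "adjacency_mat V E \<sigma>"
  define F where "F = fourier_mat ?n"
  define B where "B = F * ?A * mat_adjoint F"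
  note A = adjacency_mat_hermitian[of V E \<sigma>]
  have F: "unitary_mat ?n F" unfolding F_def by (rule unitary_fourier_mat)
  note FD = unitary_matD[OF F]
  have FA: "F * ?A \<in> carrier_mat ?n ?n" by (rule mult_carrier_mat[OF FD(1) A(1)])
  have Bc: "B \<in> carrier_mat ?n ?n" unfolding B_def by (rule mult_carrier_mat[OF FA FD(2)])
  have "E \<noteq> {}" using assms(2) by auto
  then have "V \<noteq> {}" using assms(1) by (fastforce simp: simple_graph_def)
  then have n: "?n > 0" using assms(1) by (auto simp: simple_graph_def card_gt_0_iff)
  define c where "c = 1 / complex_of_real (sqrt (real ?n))"
  have c: "c \<noteq> 0" using n by (simp add: c_def)
  have F0: "F $$ (0, x) = c" "mat_adjoint F $$ (x, 0) = c" if "x < ?n" for x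
    using that n by (auto simp: F_def fourier_mat_def c_def)
  have "B $$ (0, 0) = (\<Sum>y<?n. (F * ?A) $$ (0, y) * c)"
    unfolding B_def by (subst mult_mat_index_sum[OF FA FD(2) n n]) (simp add: F0)
  also have "\<dots> = (\<Sum>y<?n. \<Sum>x<?n. c * ?A $$ (x, y) * c)"
    by (intro sum.cong refl) (simp add: mult_mat_index_sum[OF FD(1) A(1) n] F0 sum_distrib_right)
  also have "\<dots> = c * c * (\<Sum>x<?n. \<Sum>y<?n. ?A $$ (x, y))"
    by (subst sum.swap) (simp add: sum_distrib_left mult_ac)
  finally have B00: "B $$ (0, 0) \<noteq> 0"
    using c assms(2) adjacency_mat_total[OF assms(1,3)] by simp
  have B0: "B $$ (i, 0) = 0" if i: "i < ?n" "i \<noteq> 0" for i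
  proof (rule ccontr)
    assume "B $$ (i, 0) \<noteq> 0"
    moreover have "mat_adjoint B = B"
      unfolding B_def using A FD(1,2)
      by (simp add: mat_adjoint_mult[of _ ?n ?n _ ?n] assoc_mult_mat[of _ ?n ?n _ ?n _ ?n])
    then have "B $$ (0, i) = cnj (B $$ (i, 0))"
      using Bc i n mat_adjoint_index[of 0 B i] by simp
    ultimately have "B $$ (0, i) \<noteq> 0" by simp
    then show False
      using extremal_labeling_sparse[OF assms n n i(1)] B00 i(2) by (simp add: B_def F_def)
  qed
  \<comment> \<open>Compares column 0 of both sides of
    \<open>mat_adjoint F * B = ?A * mat_adjoint F\<close>: the right side yields a row sum of
    \<open>?A\<close> times \<open>c\<close>, the left side \<open>B_00\<close> times
    \<open>c\<close>.\<close>
  have deg: "of_nat (vertex_degree E (inv_into V \<sigma> x)) = B $$ (0, 0)" if x: "x < ?n" for x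
  proof -
    have "mat_adjoint F * B = (mat_adjoint F * F) * (?A * mat_adjoint F)"
      unfolding B_def using A(1) FD(1,2)
      by (simp add: assoc_mult_mat[of _ ?n ?n _ ?n _ ?n] mult_carrier_mat[of _ ?n ?n _ ?n])
    also have "\<dots> = ?A * mat_adjoint F"
      unfolding FD(3) using A(1) FD(2) by (intro left_mult_one_mat[of _ ?n ?n] mult_carrier_mat)
    finally have eq: "mat_adjoint F * B = ?A * mat_adjoint F" .
    have "(?A * mat_adjoint F) $$ (x, 0) = (\<Sum>y<?n. ?A $$ (x, y)) * c"
      by (simp add: mult_mat_index_sum[OF A(1) FD(2) x n] F0 sum_distrib_right)
    also have "\<dots> = of_nat (vertex_degree E (inv_into V \<sigma> x)) * c"
      unfolding adjacency_mat_row_sum[OF assms(1,3) x] ..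
    finally have 1: "(?A * mat_adjoint F) $$ (x, 0) = of_nat (vertex_degree E (inv_into V \<sigma> x)) * c" .
    have "(mat_adjoint F * B) $$ (x, 0) = (\<Sum>k<?n. mat_adjoint F $$ (x, k) * B $$ (k, 0))"
      by (rule mult_mat_index_sum[OF FD(2) Bc x n])
    also have "\<dots> = (\<Sum>k\<in>{0}. mat_adjoint F $$ (x, k) * B $$ (k, 0))"
      using n B0 by (intro sum.mono_neutral_right) auto
    also have "\<dots> = c * B $$ (0, 0)" using F0 x by simp
    finally show ?thesis using 1 c unfolding eq by simp
  qed
  have "vertex_degree E v = vertex_degree E (inv_into V \<sigma> 0)" if "v \<in> V" for v
  proof -
    have "\<sigma> v < ?n" "inv_into V \<sigma> (\<sigma> v) = v"
      using assms(3) that by (auto simp: labeling_def bij_betw_def)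
    then show ?thesis using deg[of "\<sigma> v"] deg[OF n] by (metis of_nat_eq_iff)
  qed
  then show ?thesis by (rule that)
qed

section \<open>Passage to the Laplacian and the minimum over labelings\<close>

text \<open>A 0-1 matrix is determined by the positions of its ones. The finiteness makes
  \<open>Min\<close> in \<open>FR_min_projector\<close> meaningful although the labelings may form
  an infinite set of functions.\<close>

lemma finite_adjacency_mats: "finite (range (adjacency_mat V E))"
proof -
  let ?f = "\<lambda>R. mat (card V) (card V) (\<lambda>z. if z \<in> R then 1 else 0 :: complex)"
  let ?I = "{..<card V} \<times> {..<card V}"
  have "adjacency_mat V E \<tau> = ?f {z \<in> ?I. {inv_into V \<tau> (fst z), inv_into V \<tau> (snd z)} \<in> E}" for \<tau>
    by (rule eq_matI) (auto simp: adjacency_mat_def)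
  then have "range (adjacency_mat V E) \<subseteq> ?f ` Pow ?I" by blast
  then show ?thesis by (rule finite_subset) simp
qed

lemma laplacian_mat_regular:
  assumes "labeling V \<tau>" "\<And>v. v \<in> V \<Longrightarrow> vertex_degree E v = a"
  shows "laplacian_mat V E \<tau> = of_nat a \<cdot>\<^sub>m 1\<^sub>m (card V) - adjacency_mat V E \<tau>"
proof -
  have "inv_into V \<tau> x \<in> V" if "x < card V" for x
    using assms(1) that by (metis bij_betw_def inv_into_into labeling_def lessThan_iff)
  then have "degree_mat V E \<tau> = of_nat a \<cdot>\<^sub>m 1\<^sub>m (card V)"
    by (intro eq_matI) (auto simp: degree_mat_def assms(2))
  then show ?thesis by (simp add: laplacian_mat_def)
qed

lemma eigenspace_scalar_minus:
  assumes "A \<in> carrier_mat n n"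
  shows "eigenspace (c \<cdot>\<^sub>m 1\<^sub>m n - A) (c - \<mu>) = eigenspace A \<mu>"
proof -
  have "(c \<cdot>\<^sub>m 1\<^sub>m n - A) *\<^sub>v v = (c - \<mu>) \<cdot>\<^sub>v v \<longleftrightarrow> A *\<^sub>v v = \<mu> \<cdot>\<^sub>v v" if v: "v \<in> carrier_vec n" for v
  proof -
    have I: "(c \<cdot>\<^sub>m 1\<^sub>m n) *\<^sub>v v = c \<cdot>\<^sub>v v" using v
      by (intro eq_vecI) (auto simp: scalar_prod_def if_distrib[of "\<lambda>x. c * x"] if_distrib[of "\<lambda>x. x * _"] cong: if_cong)
    have "(c \<cdot>\<^sub>m 1\<^sub>m n - A) *\<^sub>v v = c \<cdot>\<^sub>v v - A *\<^sub>v v"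
      using assms v by (simp add: minus_mult_distrib_mat_vec[of _ n n] I)
    moreover have "c \<cdot>\<^sub>v v - x = (c - \<mu>) \<cdot>\<^sub>v v \<longleftrightarrow> x = \<mu> \<cdot>\<^sub>v v" if "x \<in> carrier_vec n" for x
      using that v by (auto simp: vec_eq_iff algebra_simps)
    ultimately show ?thesis using assms v by simp
  qed
  then show ?thesis using assms by (auto simp: eigenspace_def)
qed

text \<open>In an eigenbasis of \<open>A\<close> the eigenvalues become \<open>c - d i\<close>,
  which equal \<open>c - \<mu>\<close> exactly when \<open>d i = \<mu>\<close>.\<close>

lemma multiplicity_scalar_minus:
  assumes "A \<in> carrier_mat n n" "mat_adjoint A = A"
  shows "multiplicity_eigenvalue (c \<cdot>\<^sub>m 1\<^sub>m n - A) (c - \<mu>) = multiplicity_eigenvalue A \<mu>"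
proof -
  obtain U d where U: "unitary_mat n U" and A: "A = unitary_conj n U (\<lambda>i. complex_of_real (d i))"
    by (rule hermitian_spectral[OF assms])
  have "c \<cdot>\<^sub>m 1\<^sub>m n - A = unitary_conj n U (\<lambda>i. c - complex_of_real (d i))"
    using unitary_matD(1)[OF U] by (simp add: A unitary_conj_diff flip: unitary_conj_const[OF U])
  then show ?thesis by (simp add: A order_unitary_conj[OF U])
qed

lemma eigenvalue_iff_eigenspace:
  "eigenvalue A l \<longleftrightarrow> (\<exists>v\<in>eigenspace A l. v \<noteq> 0\<^sub>v (dim_row A))"
  by (auto simp: eigenvalue_def eigenvector_def eigenspace_def)

text \<open>Regularity is part of the conclusion, with \<open>a\<close> supplied by the extremal
  labeling. It makes the Laplacian and adjacency eigenspaces coincide under every labeling, and the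
  minimum is attained at \<open>\<sigma>\<close> itself.\<close>

theorem proposition2p14:
  fixes V :: "'a set" and E :: "'a set set" and \<sigma> :: "'a \<Rightarrow> nat"
  assumes "simple_graph V E"
    and "card E > 0"
    and "labeling V \<sigma>"
    and "fourier_ratio (adjacency_mat V E \<sigma>) = graph_energy V E / sqrt (2 * real (card E))"
  shows "\<exists>a. (\<forall>v\<in>V. vertex_degree E v = a) \<and>
    laplacian_mat V E \<sigma> = of_nat a \<cdot>\<^sub>m 1\<^sub>m (card V) - adjacency_mat V E \<sigma> \<and>
    (\<forall>\<mu>. eigenvalue (adjacency_mat V E \<sigma>) \<mu> \<longrightarrow>
      (let F = fourier_mat (card V); B = F * adjacency_mat V E \<sigma> * mat_adjoint F in
        \<forall>i<card V. \<forall>j<card V. i \<noteq> j \<and> B $$ (i, j) \<noteq> 0 \<longrightarrow> cmod \<mu> \<noteq> cmod (B $$ (i, j))) \<longrightarrow>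
      (let l = of_nat a - \<mu> in
        eigenvalue (laplacian_mat V E \<sigma>) l \<and>
        FR_min_projector V E l = sqrt (real (multiplicity_eigenvalue (laplacian_mat V E \<sigma>) l))))"
proof -
  let ?A = "adjacency_mat V E"
  note A = adjacency_mat_hermitian[of V E]
  obtain a where deg: "\<And>v. v \<in> V \<Longrightarrow> vertex_degree E v = a"
    using extremal_labeling_regular[OF assms] by blast
  have lap: "laplacian_mat V E \<tau> = of_nat a \<cdot>\<^sub>m 1\<^sub>m (card V) - ?A \<tau>" if "labeling V \<tau>" for \<tau>
    using that deg by (rule laplacian_mat_regular)
  have "eigenvalue (laplacian_mat V E \<sigma>) (of_nat a - \<mu>) \<and>
      FR_min_projector V E (of_nat a - \<mu>) = sqrt (real (multiplicity_eigenvalue (laplacian_mat V E \<sigma>) (of_nat a - \<mu>)))"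
    if ev: "eigenvalue (?A \<sigma>) \<mu>"
      and off: "\<And>i j. \<lbrakk>i < card V; j < card V; i \<noteq> j;
        (fourier_mat (card V) * ?A \<sigma> * mat_adjoint (fourier_mat (card V))) $$ (i, j) \<noteq> 0\<rbrakk> \<Longrightarrow>
        cmod \<mu> \<noteq> cmod ((fourier_mat (card V) * ?A \<sigma> * mat_adjoint (fourier_mat (card V))) $$ (i, j))" for \<mu>
  proof
    have es: "eigenspace (laplacian_mat V E \<tau>) (of_nat a - \<mu>) = eigenspace (?A \<tau>) \<mu>" if "labeling V \<tau>" for \<tau>
      unfolding lap[OF that] by (rule eigenspace_scalar_minus[OF A(1)])
    have "dim_row (laplacian_mat V E \<sigma>) = dim_row (?A \<sigma>)"
      by (simp add: laplacian_mat_def)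
    then show "eigenvalue (laplacian_mat V E \<sigma>) (of_nat a - \<mu>)"
      using ev by (simp add: eigenvalue_iff_eigenspace es[OF assms(3)])
    have m: "multiplicity_eigenvalue (laplacian_mat V E \<sigma>) (of_nat a - \<mu>) = multiplicity_eigenvalue (?A \<sigma>) \<mu>"
      unfolding lap[OF assms(3)] by (rule multiplicity_scalar_minus[OF A])
    let ?R = "\<lambda>\<tau>. fourier_ratio (orth_projector (card V) (eigenspace (?A \<tau>) \<mu>))"
    have "FR_min_projector V E (of_nat a - \<mu>) = Min (?R ` {\<tau>. labeling V \<tau>})"
      unfolding FR_min_projector_def laplacian_projector_def
      by (intro arg_cong[where f = Min] image_cong) (auto simp: es)
    also have "\<dots> = sqrt (real (multiplicity_eigenvalue (?A \<sigma>) \<mu>))"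
    proof (rule Min_eqI)
      have "?R ` {\<tau>. labeling V \<tau>} \<subseteq>
          (\<lambda>M. fourier_ratio (orth_projector (card V) (eigenspace M \<mu>))) ` range ?A" by auto
      then show "finite (?R ` {\<tau>. labeling V \<tau>})"
        by (rule finite_subset) (intro finite_imageI finite_adjacency_mats)
    next
      fix r assume "r \<in> ?R ` {\<tau>. labeling V \<tau>}"
      then obtain \<tau> where \<tau>: "labeling V \<tau>" "r = ?R \<tau>" by auto
      have "finite V" using assms(1) by (simp add: simple_graph_def)
      \<comment> \<open>Relabeling is a similarity, so the multiplicity in the lower bound is the
        same for every \<open>\<tau>\<close>.\<close>
      then have "char_poly (?A \<sigma>) = char_poly (?A \<tau>)"
        using assms(3) \<tau>(1) by (intro char_poly_similar similar_adjacency_mat)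
      then show "sqrt (real (multiplicity_eigenvalue (?A \<sigma>) \<mu>)) \<le> r"
        using sqrt_multiplicity_le_fourier_ratio[OF A(1)[of \<tau>] A(2)[of \<tau>], of \<mu>] \<tau>(2) by simp
    next
      have "?R \<sigma> = sqrt (real (multiplicity_eigenvalue (?A \<sigma>) \<mu>))"
        using fourier_ratio_eigenprojector[OF A] extremal_labeling_sparse[OF assms] off by blast
      then show "sqrt (real (multiplicity_eigenvalue (?A \<sigma>) \<mu>)) \<in> ?R ` {\<tau>. labeling V \<tau>}"
        using assms(3) by (metis imageI mem_Collect_eq)
    qed
    finally show "FR_min_projector V E (of_nat a - \<mu>)
        = sqrt (real (multiplicity_eigenvalue (laplacian_mat V E \<sigma>) (of_nat a - \<mu>)))"
      unfolding m .
  qed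
  then show ?thesis using deg lap[OF assms(3)] by (intro exI[of _ a]) (auto simp: Let_def)
qed

end
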